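(* Let $X$ be a complex Hilbert space with inner product $(\cdot,\cdot)$ and let $J$ be a skew-symmetric operator on $X$ with bounded inverse $J^{-1}$. Let $\mathcal{I}\subset\mathbb{R}$ be an interval and let $s\mapsto L(s)$, $s\in\mathcal{I}$, be a family of symmetric (possibly unbounded) operators on $X$ such that the family $s\mapsto JL(s)$ is resolvent-continuous on $\mathcal{I}$. Suppose $\Sigma(s)$ is a finite system of discrete eigenvalues of $JL(s)$, with associated generalized eigenspace $X_1(s)$, defined for $s$ in its maximal interval of existence $\mathcal{I}'\subset\mathcal{I}$. If for some $s_0\in\mathcal{I}'$ the real quadratic form $u\mapsto(iJ^{-1}u,u)$ is positive definite (respectively negative definite) on $X_1(s_0)$, then it is positive definite (respectively negative definite) on $X_1(s)$ for all $s\in\mathcal{I}'$. Consequently, in that case all eigenvalues in $\Sigma(s)$ are purely imaginary for all $s\in\mathcal{I}'$.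
   Context: Symmetric: $(Lu,v)=(u,Lv)$ on the domain; skew-symmetric: $(Ju,v)=-(u,Jv)$ on the domain. "Bounded inverse" means that $J^{-1}$ is a bounded operator defined on all of $X$. Resolvent-continuity: a family $s\mapsto T(s)$ of closed operators in $X$, defined for $s$ in an interval $\mathcal{I}\subset\mathbb{R}$, is resolvent-continuous on $\mathcal{I}$ if for each $s_*\in\mathcal{I}$ there exists $\xi\in\mathbb{C}$ such that the resolvent map $s\mapsto(\xi-T(s))^{-1}$ is defined and norm-continuous for $s$ in a neighborhood of $s_*$ (in $\mathcal{I}$). Discrete eigenvalue: an isolated point of the spectrum that is an eigenvalue of finite algebraic multiplicity. Finite system of discrete eigenvalues: let $T(s)$ be resolvent-continuous on $\mathcal{I}$ and let $\Sigma_*$ be a finite set of discrete eigenvalues of $T(s_* )$ for some $s_*\in\mathcal{I}$. Let $\Gamma$ be a smooth contour (e.g. a collection of small circles) enclosing $\Sigma_*$ and no other point of the spectrum of $T(s_* )$. The spectral projection $$P(s)=\frac1{2\pi i}\int_\Gamma(\xi-T(s))^{-1}\,d\xi$$ is well defined and norm-continuous for $s$ near $s_*$; its range $X_1(s)$ is $T(s)$-invariant and has constant finite dimension, and $\Sigma(s)$ denotes the set of eigenvalues of $T(s)|_{X_1(s)}$, which vary continuously with $s$. $P(s)$ does not depend on the choice of $\Gamma$, so by repeating this construction (changing contours as $s$ varies) $P(s)$, $X_1(s)$ and $\Sigma(s)$ are defined continuously for $s$ in a maximal interval $\mathcal{I}'\subset\mathcal{I}$ containing $s_*$: for each $s\in\mathcal{I}'$,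 $\Sigma(s)$ is a finite set of discrete eigenvalues of $T(s)$, $P(s)$ is the associated spectral (Riesz) projection, and $X_1(s)$ is the span of all generalized eigenvectors of $T(s)$ for eigenvalues in $\Sigma(s)$. Here this is applied with $T(s)=JL(s)$. *)

theory Defs
  imports "HOL-Complex_Analysis.Complex_Analysis"
begin

text \<open>
  Complex Hilbert spaces. The inner product is linear in its first argument; its real part is the
  library's real inner product, which fixes the norm and the topology.
\<close>

class complex_inner = real_inner +
  fixes scaleC :: "complex \<Rightarrow> 'a \<Rightarrow> 'a" (infixr \<open>*\<^sub>C\<close> 75)
    and cinner :: "'a \<Rightarrow> 'a \<Rightarrow> complex"
  assumes scaleC_add_right: "c *\<^sub>C (x + y) = c *\<^sub>C x + c *\<^sub>C y"
    and scaleC_add_left: "(c + d) *\<^sub>C x = c *\<^sub>C x + d *\<^sub>C x"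
    and scaleC_scaleC: "c *\<^sub>C d *\<^sub>C x = (c * d) *\<^sub>C x"
    and scaleR_scaleC: "r *\<^sub>R x = complex_of_real r *\<^sub>C x"
    and cinner_commute: "cinner x y = cnj (cinner y x)"
    and cinner_add_left: "cinner (x + y) z = cinner x z + cinner y z"
    and cinner_scaleC_left: "cinner (c *\<^sub>C x) y = c * cinner x y"
    and inner_cinner: "inner x y = Re (cinner x y)"

class chilbert_space = complex_inner + banach

instantiation complex :: chilbert_space
begin

definition scaleC_complex :: "complex \<Rightarrow> complex \<Rightarrow> complex"
  where "scaleC_complex c x = c * x"

definition cinner_complex :: "complex \<Rightarrow> complex \<Rightarrow> complex"
  where "cinner_complex x y = x * cnj y"

instance
  by standard
    (auto simp: scaleC_complex_def cinner_complex_def inner_complex_def algebra_simps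
      scaleR_conv_of_real)

end

text \<open>
  An unbounded operator is represented by its graph. Its domain is then \<^const>\<open>Domain\<close>, its inverse
  is \<^const>\<open>converse\<close>, and the product \<open>A B\<close> with its natural domain
  \<open>{u \<in> D(B). B u \<in> D(A)}\<close> is the relational composition \<open>B O A\<close> (in this order).
\<close>

type_synonym 'a graph = "('a \<times> 'a) set"

definition linear_operator :: "'a::complex_inner graph \<Rightarrow> bool"
  where "linear_operator T \<longleftrightarrow>
    single_valued T \<and> (0, 0) \<in> T \<and>
    (\<forall>u v u' v'. (u, v) \<in> T \<longrightarrow> (u', v') \<in> T \<longrightarrow> (u + u', v + v') \<in> T) \<and>
    (\<forall>c u v. (u, v) \<in> T \<longrightarrow> (c *\<^sub>C u, c *\<^sub>C v) \<in> T)"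

definition op_app :: "'a graph \<Rightarrow> 'a \<Rightarrow> 'a"
  where "op_app T u = (THE v. (u, v) \<in> T)"

definition symmetric_operator :: "'a::complex_inner graph \<Rightarrow> bool"
  where "symmetric_operator L \<longleftrightarrow>
    linear_operator L \<and>
    (\<forall>u\<in>Domain L. \<forall>v\<in>Domain L. cinner (op_app L u) v = cinner u (op_app L v))"

definition skew_symmetric_operator :: "'a::complex_inner graph \<Rightarrow> bool"
  where "skew_symmetric_operator J \<longleftrightarrow>
    linear_operator J \<and>
    (\<forall>u\<in>Domain J. \<forall>v\<in>Domain J. cinner (op_app J u) v = - cinner u (op_app J v))"

definition bounded_operator_graph :: "('a::real_normed_vector \<Rightarrow>\<^sub>L 'a) \<Rightarrow> 'a graph"
  where "bounded_operator_graph A = {(u, blinfun_apply A u) | u. True}"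

definition has_bounded_inverse :: "'a::real_normed_vector graph \<Rightarrow> bool"
  where "has_bounded_inverse J \<longleftrightarrow> (\<exists>B. J\<inverse> = bounded_operator_graph B)"

text \<open>
  The resolvent. Bounded operators live in the library's type of bounded real-linear maps, whose
  norm is the operator norm; the resolvent of a complex-linear operator is complex linear.
\<close>

definition shifted :: "complex \<Rightarrow> 'a::complex_inner graph \<Rightarrow> 'a graph"
  where "shifted \<xi> T = {(u, \<xi> *\<^sub>C u - v) | u v. (u, v) \<in> T}"

definition resolvent_set :: "'a::complex_inner graph \<Rightarrow> complex set"
  where "resolvent_set T = {\<xi>. has_bounded_inverse (shifted \<xi> T)}"

definition resolvent :: "'a::complex_inner graph \<Rightarrow> complex \<Rightarrow> 'a \<Rightarrow>\<^sub>L 'a"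
  where "resolvent T \<xi> = (THE R. (shifted \<xi> T)\<inverse> = bounded_operator_graph R)"

definition op_spectrum :: "'a::complex_inner graph \<Rightarrow> complex set"
  where "op_spectrum T = - resolvent_set T"

definition resolvent_continuous_on :: "real set \<Rightarrow> (real \<Rightarrow> 'a::complex_inner graph) \<Rightarrow> bool"
  where "resolvent_continuous_on I T \<longleftrightarrow>
    (\<forall>s\<in>I. linear_operator (T s) \<and> closed (T s)) \<and>
    (\<forall>s\<^sub>1\<in>I. \<exists>\<xi>. \<exists>\<delta>>0.
      (\<forall>s\<in>I \<inter> ball s\<^sub>1 \<delta>. \<xi> \<in> resolvent_set (T s)) \<and>
      continuous_on (I \<inter> ball s\<^sub>1 \<delta>) (\<lambda>s. resolvent (T s) \<xi>))"

text \<open>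
  A contour is a finite collection of closed piecewise continuously differentiable curves. It
  encloses exactly the part \<open>S\<close> of \<open>\<sigma>\<close> if it avoids \<open>\<sigma>\<close>, winds once around each point of \<open>S\<close>, and
  none of its curves winds around any other point of \<open>\<sigma>\<close>.
\<close>

definition encloses_exactly :: "(real \<Rightarrow> complex) list \<Rightarrow> complex set \<Rightarrow> complex set \<Rightarrow> bool"
  where "encloses_exactly \<Gamma> S \<sigma> \<longleftrightarrow>
    S \<subseteq> \<sigma> \<and>
    (\<forall>\<gamma>\<in>set \<Gamma>. valid_path \<gamma> \<and> pathfinish \<gamma> = pathstart \<gamma> \<and> path_image \<gamma> \<inter> \<sigma> = {}) \<and>
    (\<forall>z\<in>S. (\<Sum>\<gamma>\<leftarrow>\<Gamma>. winding_number \<gamma> z) = 1) \<and>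
    (\<forall>z\<in>\<sigma> - S. \<forall>\<gamma>\<in>set \<Gamma>. winding_number \<gamma> z = 0)"

definition scaleC_blinfun :: "complex \<Rightarrow> ('a::complex_inner \<Rightarrow>\<^sub>L 'a) \<Rightarrow> ('a \<Rightarrow>\<^sub>L 'a)"
  where "scaleC_blinfun c A = Blinfun (\<lambda>u. c *\<^sub>C blinfun_apply A u)"

definition resolvent_integral :: "(real \<Rightarrow> complex) \<Rightarrow> 'a::complex_inner graph \<Rightarrow> ('a \<Rightarrow>\<^sub>L 'a)"
  where "resolvent_integral \<gamma> T =
    integral {0..1}
      (\<lambda>t. scaleC_blinfun (vector_derivative \<gamma> (at t within {0..1})) (resolvent T (\<gamma> t)))"

definition spectral_projection :: "(real \<Rightarrow> complex) list \<Rightarrow> 'a::complex_inner graph \<Rightarrow> ('a \<Rightarrow>\<^sub>L 'a)"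
  where "spectral_projection \<Gamma> T =
    scaleC_blinfun (1 / (2 * complex_of_real pi * \<i>)) (\<Sum>\<gamma>\<leftarrow>\<Gamma>. resolvent_integral \<gamma> T)"

definition eigenvalues_on :: "'a::complex_inner graph \<Rightarrow> 'a set \<Rightarrow> complex set"
  where "eigenvalues_on T X = {z. \<exists>u\<in>X. u \<noteq> 0 \<and> (u, z *\<^sub>C u) \<in> T}"

text \<open>
  The algebraic multiplicity of an isolated point of the spectrum is the rank of its spectral
  projection. The library's \<^const>\<open>span\<close> is the real span, but finiteness of the real and of the
  complex dimension are the same.
\<close>

definition finite_dimensional :: "'a::real_vector set \<Rightarrow> bool"
  where "finite_dimensional X \<longleftrightarrow> (\<exists>B. finite B \<and> X \<subseteq> span B)"

definition discrete_eigenvalues :: "'a::complex_inner graph \<Rightarrow> complex set"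
  where "discrete_eigenvalues T = {z \<in> eigenvalues_on T UNIV.
    \<exists>r>0. op_spectrum T \<inter> cball z r = {z} \<and>
      finite_dimensional (range (blinfun_apply (spectral_projection [circlepath z r] T)))}"

text \<open>
  A finite system of discrete eigenvalues \<open>S s\<close> with spectral projections \<open>P s\<close>: around each
  parameter value it is obtained from a fixed contour.
\<close>

definition eigenvalue_system ::
    "real set \<Rightarrow> (real \<Rightarrow> 'a::complex_inner graph) \<Rightarrow> (real \<Rightarrow> complex set) \<Rightarrow> (real \<Rightarrow> 'a \<Rightarrow>\<^sub>L 'a) \<Rightarrow> bool"
  where "eigenvalue_system I T S P \<longleftrightarrow>
    is_interval I \<and> I \<noteq> {} \<and>
    (\<forall>s\<^sub>1\<in>I. finite (S s\<^sub>1) \<and> S s\<^sub>1 \<subseteq> discrete_eigenvalues (T s\<^sub>1) \<and>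
      (\<exists>\<Gamma>. encloses_exactly \<Gamma> (S s\<^sub>1) (op_spectrum (T s\<^sub>1)) \<and>
        (\<exists>\<delta>>0. \<forall>s\<in>I \<inter> ball s\<^sub>1 \<delta>.
          (\<forall>\<gamma>\<in>set \<Gamma>. path_image \<gamma> \<subseteq> resolvent_set (T s)) \<and>
          P s = spectral_projection \<Gamma> (T s) \<and>
          S s = eigenvalues_on (T s) (range (blinfun_apply (P s))))))"

definition maximal_eigenvalue_system ::
    "real set \<Rightarrow> real set \<Rightarrow> (real \<Rightarrow> 'a::complex_inner graph) \<Rightarrow> (real \<Rightarrow> complex set) \<Rightarrow>
      (real \<Rightarrow> 'a \<Rightarrow>\<^sub>L 'a) \<Rightarrow> bool"
  where "maximal_eigenvalue_system I I' T S P \<longleftrightarrow>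
    I' \<subseteq> I \<and> eigenvalue_system I' T S P \<and>
    (\<forall>I'' S' P'. I' \<subseteq> I'' \<longrightarrow> I'' \<subseteq> I \<longrightarrow> eigenvalue_system I'' T S' P' \<longrightarrow>
      (\<forall>s\<in>I'. S' s = S s) \<longrightarrow> I'' = I')"

text \<open>
  For skew-symmetric \<open>J\<close> with bounded inverse, \<open>(i J\<^sup>-\<^sup>1 u, u)\<close> is real, so taking the real part
  only changes the type.
\<close>

definition energy_form :: "'a::complex_inner graph \<Rightarrow> 'a \<Rightarrow> real"
  where "energy_form J u = Re (cinner (\<i> *\<^sub>C op_app (J\<inverse>) u) u)"

definition positive_definite_on :: "'a::zero set \<Rightarrow> ('a \<Rightarrow> real) \<Rightarrow> bool"
  where "positive_definite_on X q \<longleftrightarrow> (\<forall>u\<in>X. u \<noteq> 0 \<longrightarrow> q u > 0)"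

definition negative_definite_on :: "'a::zero set \<Rightarrow> ('a \<Rightarrow> real) \<Rightarrow> bool"
  where "negative_definite_on X q \<longleftrightarrow> (\<forall>u\<in>X. u \<noteq> 0 \<longrightarrow> q u < 0)"

end

theory Submission
  imports Defs
begin

text \<open>
  The form \<open>[u, v] = (i J\<^sup>-\<^sup>1 u, v)\<close> is bounded, Hermitian and nondegenerate, and \<open>J L(s)\<close> is
  skew-symmetric with respect to it. If it is definite on \<open>X\<^sub>1(s)\<close>, then evaluating it on an
  eigenvector shows that \<open>\<Sigma>(s)\<close> lies on the imaginary axis; small circles around the points of \<open>\<Sigma>(s)\<close>
  are then invariant under \<open>\<xi> \<mapsto> - cnj \<xi>\<close>, so that \<open>[P(s) u, v] = [u, P(s) v]\<close>. The set of \<open>s\<close> at which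
  the form is positive definite on \<open>X\<^sub>1(s)\<close> is open because the projections are norm continuous and
  have finite rank. It is closed: in the limit the form is semidefinite on \<open>X\<^sub>1\<close> and \<open>P\<close> is still
  symmetric, so a null vector of the form in \<open>X\<^sub>1\<close> is orthogonal to \<open>X\<^sub>1\<close> by the Cauchy-Schwarz
  inequality, hence to the whole space, and vanishes by nondegeneracy.
\<close>

section \<open>Complex inner products\<close>

text \<open>The projection is known to be symmetric only where the form is already definite, because
  only there is the system known to lie on the imaginary axis. At a limit parameter symmetry is
  therefore not read off the spectrum but inherited, as a norm limit of identities. The negative
  definite case is the positive one with \<open>- \<i>\<close> in place of \<open>\<i>\<close>. The
  definiteness argument lives in a real inner product space with a bounded symmetric
  \<open>A\<close>; the spectral side only has to deliver projections that are idempotent, norm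
  continuous, of finite rank, and symmetric wherever the form is definite. A contour from the
  definition is arbitrary and has no reflection symmetry, so it is traded for circles by the residue
  theorem. Matrix elements \<open>cinner (R u) v\<close> carry this over to scalar complex analysis.
  The quantitative obstacle is norm continuity: resolvent continuity is given at a single point of
  the plane for each parameter, and has to be transported uniformly to a neighbourhood of a whole
  contour.\<close>

lemma cinner_scaleC_right: "cinner x (c *\<^sub>C y) = cnj c * cinner x (y::'a::complex_inner)"
  by (metis cinner_commute cinner_scaleC_left complex_cnj_mult)

lemma cinner_add_right: "cinner x (y + z) = cinner x y + cinner x (z::'a::complex_inner)"
  by (metis cinner_add_left cinner_commute complex_cnj_add)

text \<open>The class ties complex scalars to the norm only through
  \<open>inner x y = Re (cinner x y)\<close>. Since \<open>cinner x x\<close> is real,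
  \<open>c * cnj c\<close> factors out of the real part.\<close>

lemma norm_scaleC: "norm (c *\<^sub>C x) = cmod c * norm (x::'a::complex_inner)"
proof -
  have "Im (cinner x x) = 0"
    using cinner_commute[of x x] by (metis Reals_cnj_iff complex_is_Real_iff)
  then have "inner (c *\<^sub>C x) (c *\<^sub>C x) = (cmod c)\<^sup>2 * inner x x"
    by (simp add: inner_cinner cinner_scaleC_left cinner_scaleC_right cmod_power2)
      (simp add: power2_eq_square algebra_simps)
  then have "(norm (c *\<^sub>C x))\<^sup>2 = (cmod c * norm x)\<^sup>2"
    by (simp add: power2_norm_eq_inner power_mult_distrib)
  then show ?thesis by (simp add: power2_eq_iff_nonneg)
qed

lemma bounded_bilinear_scaleC:
  "bounded_bilinear (scaleC :: complex \<Rightarrow> 'a \<Rightarrow> 'a::complex_inner)"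
proof
  show "\<exists>K. \<forall>a b. norm (a *\<^sub>C (b::'a)) \<le> norm a * norm b * K"
    by (rule exI[of _ 1]) (simp add: norm_scaleC)
qed (simp_all add: scaleC_add_left scaleC_add_right scaleR_scaleC[where 'a='a] scaleC_scaleC scaleR_conv_of_real mult.commute)

interpretation scaleC: bounded_bilinear "scaleC :: complex \<Rightarrow> 'a \<Rightarrow> 'a::complex_inner"
  by (rule bounded_bilinear_scaleC)

lemma bounded_bilinear_cinner:
  "bounded_bilinear (cinner :: 'a::complex_inner \<Rightarrow> 'a \<Rightarrow> complex)"
proof
  have Re: "\<bar>Re (cinner a b)\<bar> \<le> norm a * norm b" for a b :: 'a
    by (metis Cauchy_Schwarz_ineq2 inner_cinner)
  \<comment> \<open>\<open>Re (\<i> * z) = - Im z\<close>: rotating the first argument reduces the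
    imaginary part to the real one.\<close>
  have Im: "\<bar>Im (cinner a b)\<bar> \<le> norm a * norm b" for a b :: 'a
    using Re[of "\<i> *\<^sub>C a" b] by (simp add: cinner_scaleC_left norm_scaleC)
  have "norm (cinner a b) \<le> norm a * norm b * 2" for a b :: 'a
    using cmod_le[of "cinner a b"] Re[of a b] Im[of a b] by linarith
  then show "\<exists>K. \<forall>a b. norm (cinner a (b::'a)) \<le> norm a * norm b * K" by blast
qed (simp_all add: cinner_add_left cinner_add_right scaleR_scaleC[where 'a='a] cinner_scaleC_left
    cinner_scaleC_right scaleR_conv_of_real)

interpretation cinner: bounded_bilinear "cinner :: 'a::complex_inner \<Rightarrow> 'a \<Rightarrow> complex"
  by (rule bounded_bilinear_cinner)

lemma cinner_ext:
  assumes "\<And>v. cinner u v = cinner u' (v::'a::complex_inner)"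
  shows "u = u'"
  by (metis assms cinner.diff_left cinner.zero_left inner_cinner inner_eq_zero_iff right_minus_eq zero_complex.simps(1))

lemma blinfun_apply_scaleC_blinfun [simp]:
  "blinfun_apply (scaleC_blinfun c A) u = c *\<^sub>C blinfun_apply A u"
  unfolding scaleC_blinfun_def
  by (subst bounded_linear_Blinfun_apply)
    (auto intro: bounded_linear_compose[OF scaleC.bounded_linear_right blinfun.bounded_linear_right])

lemma bounded_bilinear_scaleC_blinfun:
  "bounded_bilinear (scaleC_blinfun :: complex \<Rightarrow> ('a \<Rightarrow>\<^sub>L 'a) \<Rightarrow> ('a::complex_inner \<Rightarrow>\<^sub>L 'a))"
proof
  have "norm (scaleC_blinfun a b) \<le> norm a * norm b" for a and b :: "'a \<Rightarrow>\<^sub>L 'a"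
  proof (rule norm_blinfun_bound)
    show "norm (blinfun_apply (scaleC_blinfun a b) x) \<le> norm a * norm b * norm x" for x
      using mult_left_mono[OF norm_blinfun[of b x], of "norm a"]
      by (simp add: norm_scaleC mult.assoc)
  qed simp
  then show "\<exists>K. \<forall>a b. norm (scaleC_blinfun a (b::'a \<Rightarrow>\<^sub>L 'a)) \<le> norm a * norm b * K"
    by (intro exI[of _ 1]) simp
qed (auto intro!: blinfun_eqI simp: blinfun.bilinear_simps scaleC.add_left scaleC.add_right
    scaleC.scaleR_left scaleC.scaleR_right)

interpretation scaleCb: bounded_bilinear
    "scaleC_blinfun :: complex \<Rightarrow> ('a \<Rightarrow>\<^sub>L 'a) \<Rightarrow> ('a::complex_inner \<Rightarrow>\<^sub>L 'a)"
  by (rule bounded_bilinear_scaleC_blinfun)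

lemma norm_scaleC_blinfun: "norm (scaleC_blinfun c A) \<le> cmod c * norm A"
  by (rule norm_blinfun_bound)
    (auto simp: norm_scaleC mult.assoc intro!: mult_left_mono norm_blinfun)

section \<open>Forms on the range of a continuous family of projections\<close>

text \<open>Gram-Schmidt for the form. Both claims go through one induction because the orthogonal
  projection onto \<open>span B\<close> splits off the new generator, and along that splitting the
  lower bounds add up.\<close>

lemma coercive_on_span:
  fixes A :: "'a::real_inner \<Rightarrow>\<^sub>L 'a"
  assumes sym: "\<And>u v. inner (A u) v = inner u (A v)"
    and "finite B"
    and "\<And>u. u \<in> span B \<Longrightarrow> u \<noteq> 0 \<Longrightarrow> inner (A u) u > 0"
  shows "(\<exists>c>0. \<forall>u\<in>span B. c * (norm u)\<^sup>2 \<le> inner (A u) u) \<and>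
    (\<forall>w. \<exists>p\<in>span B. \<forall>v\<in>span B. inner (A (w - p)) v = 0)"
  using assms(2,3)
proof (induction B rule: finite_induct)
  case empty
  show ?case by (auto intro!: exI[of _ 1])
next
  case (insert b B)
  have pos: "inner (A u) u > 0" if "u \<in> span B" "u \<noteq> 0" for u
    using insert.prems that span_mono[of B "insert b B"] by blast
  obtain c where c: "c > 0" "\<And>u. u \<in> span B \<Longrightarrow> c * (norm u)\<^sup>2 \<le> inner (A u) u"
    using insert.IH pos by blast
  have proj: "\<exists>p\<in>span B. \<forall>v\<in>span B. inner (A (w - p)) v = 0" for w
    using insert.IH pos by blast
  show ?case
  proof (cases "b \<in> span B")
    case True
    then have "span (insert b B) = span B" by (rule span_redundant)
    then show ?thesis using insert.IH pos by simp
  next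
    case False
    obtain p where p: "p \<in> span B" "\<And>v. v \<in> span B \<Longrightarrow> inner (A (b - p)) v = 0"
      using proj by blast
    define e where "e = b - p"
    have e: "inner (A e) v = 0" if "v \<in> span B" for v
      using p that by (simp add: e_def)
    have "e \<noteq> 0" using False p by (auto simp: e_def)
    have espan: "e \<in> span (insert b B)"
      unfolding e_def using p(1) span_mono[of B "insert b B"] span_base[of b "insert b B"]
      by (intro span_diff) auto
    define q where "q = inner (A e) e"
    have q: "q > 0" using insert.prems[OF espan \<open>e \<noteq> 0\<close>] by (simp add: q_def)
    have decomp: "\<exists>v t. v \<in> span B \<and> u = v + t *\<^sub>R e" if u: "u \<in> span (insert b B)" for u
    proof -
      obtain k where "u - k *\<^sub>R b \<in> span B" using u span_breakdown_eq by blast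
      then have "(u - k *\<^sub>R b) + k *\<^sub>R p \<in> span B" using p by (intro span_add span_scale) auto
      then show ?thesis
        by (intro exI[of _ "(u - k *\<^sub>R b) + k *\<^sub>R p"] exI[of _ k]) (simp add: e_def algebra_simps)
    qed
    have form: "inner (A (v + t *\<^sub>R e)) (v + t *\<^sub>R e) = inner (A v) v + t\<^sup>2 * q" if "v \<in> span B" for v t
      using e[OF that] sym[of v e]
      by (simp add: q_def blinfun.bilinear_simps inner_add_left inner_add_right power2_eq_square inner_commute)
    \<comment> \<open>From \<open>(norm v + |t| norm e)^2 \<le> 2 (norm v)^2 + 2 t^2 (norm
      e)^2\<close>: \<open>2 / c\<close> pays for the \<open>v\<close> part,
      \<open>2 (norm e)^2 / q\<close> for the \<open>e\<close> part, and the sum dominates each. The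
      new coercivity constant is \<open>1 / K\<close>.\<close>
    define K where "K = 2 / c + 2 * (norm e)\<^sup>2 / q"
    have K: "K > 0" unfolding K_def using c q by (simp add: add_pos_nonneg)
    have coer: "(norm u)\<^sup>2 \<le> K * inner (A u) u" if "u \<in> span (insert b B)" for u
    proof -
      obtain v t where vt: "v \<in> span B" "u = v + t *\<^sub>R e" using decomp[OF \<open>u \<in> span (insert b B)\<close>] by blast
      have "norm u \<le> norm v + \<bar>t\<bar> * norm e" unfolding vt using norm_triangle_ineq[of v "t *\<^sub>R e"] by simp
      then have "(norm u)\<^sup>2 \<le> (norm v + \<bar>t\<bar> * norm e)\<^sup>2" by (simp add: power_mono)
      also have "\<dots> \<le> 2 * (norm v)\<^sup>2 + 2 * (\<bar>t\<bar> * norm e)\<^sup>2"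
        using sum_squares_bound[of "norm v" "\<bar>t\<bar> * norm e"] by (simp add: power2_sum)
      also have "\<dots> \<le> (2 / c) * inner (A v) v + (2 * (norm e)\<^sup>2 / q) * (t\<^sup>2 * q)"
        using c(2)[OF vt(1)] c(1) q by (simp add: field_simps power_mult_distrib)
      also have "\<dots> \<le> K * inner (A v) v + K * (t\<^sup>2 * q)"
      proof -
        have "0 \<le> inner (A v) v" using pos[OF vt(1)] by (cases "v = 0") auto
        then show ?thesis unfolding K_def using c q
          by (intro add_mono mult_right_mono) auto
      qed
      also have "\<dots> = K * inner (A u) u" using form[OF vt(1)] vt(2) by (simp add: distrib_left)
      finally show ?thesis .
    qed
    have "\<exists>p'\<in>span (insert b B). \<forall>v\<in>span (insert b B). inner (A (w - p')) v = 0" for w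
    proof -
      obtain r where r: "r \<in> span B" "\<And>v. v \<in> span B \<Longrightarrow> inner (A (w - r)) v = 0"
        using proj by blast
      \<comment> \<open>The multiple of \<open>e\<close> that cancels the pairing with
        \<open>e\<close>; pairings with \<open>span B\<close> stay zero because \<open>e\<close> is
        orthogonal to it.\<close>
      define k where "k = inner (A (w - r)) e / q"
      have "inner (A (w - (r + k *\<^sub>R e))) v = 0" if "v \<in> span (insert b B)" for v
      proof -
        obtain v' t where vt: "v' \<in> span B" "v = v' + t *\<^sub>R e" using decomp[OF \<open>v \<in> span (insert b B)\<close>] by blast
        have "inner (A (w - (r + k *\<^sub>R e))) v = inner (A (w - r)) v - k * inner (A e) v"
          by (simp add: blinfun.bilinear_simps algebra_simps)
        also have "\<dots> = t * inner (A (w - r)) e - k * (t * q)"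
          using r(2)[OF vt(1)] e[OF vt(1)] by (simp add: vt(2) inner_add_right q_def)
        also have "\<dots> = 0" using q by (simp add: k_def)
        finally show ?thesis .
      qed
      moreover have "r + k *\<^sub>R e \<in> span (insert b B)"
        using r(1) espan span_mono[of B "insert b B"] by (intro span_add span_scale) auto
      ultimately show ?thesis by blast
    qed
    moreover have "\<exists>c>0. \<forall>u\<in>span (insert b B). c * (norm u)\<^sup>2 \<le> inner (A u) u"
      using K coer by (intro exI[of _ "1 / K"]) (simp add: field_simps)
    ultimately show ?thesis by blast
  qed
qed

text \<open>The finite set in \<open>finite_dimensional X\<close> may span more than
  \<open>X\<close>, where positivity is unknown. A basis chosen inside \<open>X\<close> is finite by
  comparison with that set and spans exactly \<open>X\<close>.\<close>

lemma coercive_on_finite_dimensional: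
  fixes A :: "'a::real_inner \<Rightarrow>\<^sub>L 'a"
  assumes sym: "\<And>u v. inner (A u) v = inner u (A v)"
    and fd: "finite_dimensional X" and sub: "subspace X"
    and pos: "positive_definite_on X (\<lambda>u. inner (A u) u)"
  shows "\<exists>c>0. \<forall>u\<in>X. c * (norm u)\<^sup>2 \<le> inner (A u) u"
proof -
  obtain C where C: "C \<subseteq> X" "independent C" "X \<subseteq> span C" using basis_exists[of X] by metis
  obtain F where F: "finite F" "X \<subseteq> span F" using fd by (auto simp: finite_dimensional_def)
  have "finite C" using independent_span_bound[OF F(1) C(2) subset_trans[OF C(1) F(2)]] by simp
  have "span C = X" using span_subspace[OF C(1,3) sub] .
  with pos have "inner (A u) u > 0" if "u \<in> span C" "u \<noteq> 0" for u
    using that unfolding positive_definite_on_def by blast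
  from coercive_on_span[OF sym \<open>finite C\<close> this] show ?thesis
    unfolding \<open>span C = X\<close> by blast
qed

text \<open>The equality case of Cauchy-Schwarz: along \<open>u + t *\<^sub>R v\<close> the form is
  \<open>2 t b + t^2 d\<close>, which is negative for some small \<open>t\<close> unless
  \<open>b = 0\<close>.\<close>

lemma semidefinite_null:
  fixes A :: "'a::real_inner \<Rightarrow>\<^sub>L 'a"
  assumes sym: "\<And>u v. inner (A u) v = inner u (A v)"
    and sub: "subspace X" and psd: "\<And>u. u \<in> X \<Longrightarrow> inner (A u) u \<ge> 0"
    and u: "u \<in> X" "inner (A u) u = 0" and v: "v \<in> X"
  shows "inner (A u) v = 0"
proof (rule ccontr)
  define b where "b = inner (A u) v"
  define d where "d = inner (A v) v"
  assume "inner (A u) v \<noteq> 0"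
  then have "b \<noteq> 0" by (simp add: b_def)
  have d: "d \<ge> 0" using psd v by (simp add: d_def)
  \<comment> \<open>The minimizer would be \<open>- b / d\<close>; the denominator
    \<open>d + 1\<close> also covers \<open>d = 0\<close>.\<close>
  define t where "t = - b / (d + 1)"
  have "u + t *\<^sub>R v \<in> X" using sub u v by (simp add: subspace_add subspace_scale)
  then have "0 \<le> inner (A (u + t *\<^sub>R v)) (u + t *\<^sub>R v)" by (rule psd)
  also have "\<dots> = 2 * t * b + t\<^sup>2 * d"
    using u sym[of v u]
    by (simp add: blinfun.bilinear_simps inner_add_left inner_add_right b_def d_def power2_eq_square inner_commute algebra_simps)
  also have "\<dots> = - (b\<^sup>2 * (d + 2) / (d + 1)\<^sup>2)"
    using d by (simp add: t_def field_simps power2_eq_square add_nonneg_eq_0_iff)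
  also have "\<dots> < 0" using d \<open>b \<noteq> 0\<close> by simp
  finally show False by simp
qed

lemma subspace_range_blinfun: "subspace (range (blinfun_apply P))"
  by (metis blinfun.bounded_linear_right bounded_linear.linear linear_subspace_image subspace_UNIV)

text \<open>Idempotence gives \<open>Q u = u\<close> on the range of \<open>Q\<close>, so
  \<open>P u\<close> is within \<open>\<epsilon> * norm u\<close> of \<open>u\<close>, and
  coercivity on the range of \<open>P\<close> absorbs the error.\<close>

lemma positive_definite_range_open:
  fixes A :: "'a::real_inner \<Rightarrow>\<^sub>L 'a"
  assumes sym: "\<And>u v. inner (A u) v = inner u (A v)"
    and fd: "finite_dimensional (range (blinfun_apply P))"
    and pos: "positive_definite_on (range (blinfun_apply P)) (\<lambda>u. inner (A u) u)"
  shows "\<exists>\<epsilon>>0. \<forall>Q. norm (Q - P) < \<epsilon> \<longrightarrow> Q o\<^sub>L Q = Q \<longrightarrow>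
    positive_definite_on (range (blinfun_apply Q)) (\<lambda>u. inner (A u) u)"
proof -
  obtain c where c: "c > 0" "\<And>u. c * (norm (P u))\<^sup>2 \<le> inner (A (P u)) (P u)"
    using coercive_on_finite_dimensional[OF sym fd subspace_range_blinfun pos] by blast
  define a where "a = norm A"
  have a: "a \<ge> 0" by (simp add: a_def)
  \<comment> \<open>The bound \<open>1/2\<close> keeps \<open>norm (P u)\<close> between
    \<open>n / 2\<close> and \<open>2 * n\<close>. The two error terms total at most
    \<open>3 * a * \<epsilon> * n^2\<close> against a main term \<open>c * n^2 / 4\<close>, so
    \<open>16 * a * \<epsilon> < c\<close> suffices. The \<open>+ 1\<close> covers
    \<open>A = 0\<close>.\<close>
  define \<epsilon> where "\<epsilon> = min (1/2) (c / (16 * (a + 1)))"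
  have e: "\<epsilon> > 0" "\<epsilon> \<le> 1/2" using c a by (auto simp: \<epsilon>_def min.coboundedI1 simp del: distrib_left_numeral distrib_right_numeral)
  have "\<epsilon> \<le> c / (16 * (a + 1))" by (simp add: \<epsilon>_def)
  then have e3: "16 * (a + 1) * \<epsilon> \<le> c" using a by (simp add: pos_le_divide_eq mult.commute)
  have "inner (A u) u > 0" if Q: "norm (Q - P) < \<epsilon>" "Q o\<^sub>L Q = Q" and u: "u \<in> range (blinfun_apply Q)" "u \<noteq> 0" for Q u
  proof -
    have Qu: "Q u = u" using Q(2) u(1) by (metis blinfun_apply_blinfun_compose rangeE)
    define n where "n = norm u"
    have n: "n > 0" using u by (simp add: n_def)
    define w where "w = P u"
    have "norm (u - w) = norm ((Q - P) u)" by (simp add: Qu w_def blinfun.bilinear_simps)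
    also have "\<dots> \<le> norm (Q - P) * n" unfolding n_def by (rule norm_blinfun)
    also have "\<dots> \<le> \<epsilon> * n" using Q n by simp
    finally have d: "norm (u - w) \<le> \<epsilon> * n" .
    have w1: "norm w \<ge> n / 2"
    proof -
      have "\<epsilon> * n \<le> n / 2" using e n by simp
      moreover have "n \<le> norm w + norm (u - w)" unfolding n_def using norm_triangle_ineq[of w "u - w"] by simp
      ultimately show ?thesis using d by linarith
    qed
    have w2: "norm w \<le> 2 * n"
    proof -
      have "\<epsilon> * n \<le> n / 2" using e n by simp
      moreover have "norm w \<le> n + norm (u - w)" unfolding n_def by (metis norm_minus_commute norm_triangle_sub)
      ultimately show ?thesis using d n by linarith
    qed
    have "inner (A u) u = inner (A w) w + inner (A (u - w)) u + inner (A w) (u - w)"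
      by (simp add: blinfun.bilinear_simps algebra_simps)
    moreover have "\<bar>inner (A (u - w)) u\<bar> \<le> a * (\<epsilon> * n) * n"
    proof -
      have "\<bar>inner (A (u - w)) u\<bar> \<le> norm (A (u - w)) * n" unfolding n_def by (rule Cauchy_Schwarz_ineq2)
      also have "\<dots> \<le> (a * norm (u - w)) * n" unfolding a_def using n by (intro mult_right_mono norm_blinfun) auto
      also have "\<dots> \<le> (a * (\<epsilon> * n)) * n" using d n a by (intro mult_right_mono mult_left_mono) auto
      finally show ?thesis .
    qed
    moreover have "\<bar>inner (A w) (u - w)\<bar> \<le> a * (2 * n) * (\<epsilon> * n)"
    proof -
      have "\<bar>inner (A w) (u - w)\<bar> \<le> norm (A w) * norm (u - w)" by (rule Cauchy_Schwarz_ineq2)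
      also have "\<dots> \<le> (a * norm w) * norm (u - w)" unfolding a_def by (intro mult_right_mono norm_blinfun) auto
      also have "\<dots> \<le> (a * (2 * n)) * (\<epsilon> * n)" using d n a w2 by (intro mult_mono) auto
      finally show ?thesis .
    qed
    moreover have "inner (A w) w \<ge> c * (n / 2)\<^sup>2"
      using c(2)[of u] w1 c(1) n by (smt (verit) power_mono mult_left_mono w_def divide_nonneg_nonneg)
    moreover have "c * (n / 2)\<^sup>2 - 3 * (a * \<epsilon>) * n\<^sup>2 > 0"
    proof -
      have "16 * (a * \<epsilon>) < c" using e e3 a by (simp add: algebra_simps)
      moreover have "0 \<le> a * \<epsilon>" using a e(1) by simp
      ultimately have "(c / 4 - 3 * (a * \<epsilon>)) * n\<^sup>2 > 0" using n
        by (intro mult_pos_pos) auto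
      then show ?thesis by (simp add: power_divide algebra_simps)
    qed
    ultimately show ?thesis by (simp add: power2_eq_square algebra_simps)
  qed
  then show ?thesis using e(1) unfolding positive_definite_on_def by blast
qed

lemma positive_definite_range_limit:
  fixes A :: "'a::real_inner \<Rightarrow>\<^sub>L 'a" and P :: "nat \<Rightarrow> 'a \<Rightarrow>\<^sub>L 'a"
  assumes sym: "\<And>u v. inner (A u) v = inner u (A v)" and inj: "\<And>u. A u = 0 \<Longrightarrow> u = 0"
    and lim: "P \<longlonglongrightarrow> Q" and Q: "Q o\<^sub>L Q = Q"
    and pos: "\<And>n. positive_definite_on (range (blinfun_apply (P n))) (\<lambda>u. inner (A u) u)"
    and Psym: "\<And>n u v. inner (A (P n u)) v = inner (A u) (P n v)"
  shows "positive_definite_on (range (blinfun_apply Q)) (\<lambda>u. inner (A u) u)"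
proof -
  have limu: "(\<lambda>n. P n u) \<longlonglongrightarrow> Q u" for u by (intro tendsto_intros lim)
  have limA: "(\<lambda>n. inner (A (P n u)) v) \<longlonglongrightarrow> inner (A (Q u)) v" for u v
    by (intro tendsto_intros limu)
  moreover have "(\<lambda>n. inner (A u) (P n v)) \<longlonglongrightarrow> inner (A u) (Q v)" for u v
    by (intro tendsto_intros limu)
  ultimately have Qsym: "inner (A (Q u)) v = inner (A u) (Q v)" for u v
    using Psym by (intro LIMSEQ_unique[of "\<lambda>n. inner (A (P n u)) v"]) auto
  have psd: "inner (A u) u \<ge> 0" if u: "u \<in> range (blinfun_apply Q)" for u
  proof -
    obtain x where x: "u = Q x" using u by auto
    have "(\<lambda>n. inner (A (P n x)) (P n x)) \<longlonglongrightarrow> inner (A (Q x)) (Q x)"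
      by (intro tendsto_intros limu)
    moreover have "inner (A (P n x)) (P n x) \<ge> 0" for n
      using pos[of n] unfolding positive_definite_on_def by (cases "P n x = 0") (auto intro: less_imp_le)
    ultimately show ?thesis unfolding x by (intro LIMSEQ_le_const) auto
  qed
  have "inner (A u) u > 0" if u: "u \<in> range (blinfun_apply Q)" "u \<noteq> 0" for u
  proof (rule ccontr)
    assume "\<not> inner (A u) u > 0"
    then have 0: "inner (A u) u = 0" using psd u by force
    have Qu: "Q u = u" using Q u(1) by (metis blinfun_apply_blinfun_compose rangeE)
    have "inner (A u) v = 0" for v
    proof -
      \<comment> \<open>Symmetry of \<open>Q\<close> and \<open>Q u = u\<close> move an arbitrary
        test vector into the range, where semidefiniteness is known.\<close>
      have "inner (A u) v = inner (A u) (Q v)" using Qsym[of u v] Qu by simp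
      also have "\<dots> = 0"
        by (rule semidefinite_null[OF sym subspace_range_blinfun psd u(1) 0]) auto
      finally show ?thesis .
    qed
    then have "A u = 0" by (metis inner_eq_zero_iff)
    then show False using inj u by blast
  qed
  then show ?thesis by (simp add: positive_definite_on_def)
qed

text \<open>\<open>Psym\<close> is demanded only at parameters where the form is already definite,
  which is all that the spectral argument can supply. The sequence used for closedness consists of
  such parameters.\<close>

proposition positive_definite_range_continuation:
  fixes A :: "'a::real_inner \<Rightarrow>\<^sub>L 'a" and P :: "real \<Rightarrow> 'a \<Rightarrow>\<^sub>L 'a"
  assumes sym: "\<And>u v. inner (A u) v = inner u (A v)" and inj: "\<And>u. A u = 0 \<Longrightarrow> u = 0"
    and "connected I" and cont: "continuous_on I P"
    and idem: "\<And>s. s \<in> I \<Longrightarrow> P s o\<^sub>L P s = P s"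
    and fd: "\<And>s. s \<in> I \<Longrightarrow> finite_dimensional (range (blinfun_apply (P s)))"
    and Psym: "\<And>s u v. s \<in> I \<Longrightarrow>
      positive_definite_on (range (blinfun_apply (P s))) (\<lambda>u. inner (A u) u) \<Longrightarrow>
      inner (A (P s u)) v = inner (A u) (P s v)"
    and s0: "s\<^sub>0 \<in> I" "positive_definite_on (range (blinfun_apply (P s\<^sub>0))) (\<lambda>u. inner (A u) u)"
    and "s \<in> I"
  shows "positive_definite_on (range (blinfun_apply (P s))) (\<lambda>u. inner (A u) u)"
proof -
  let ?pos = "\<lambda>s. positive_definite_on (range (blinfun_apply (P s))) (\<lambda>u. inner (A u) u)"
  define G where "G = {s \<in> I. ?pos s}"
  have "openin (top_of_set I) G"
    unfolding openin_euclidean_subtopology_iff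
  proof (intro conjI ballI)
    fix x assume x: "x \<in> G"
    then obtain \<epsilon> where \<epsilon>: "\<epsilon> > 0" "\<And>Q. norm (Q - P x) < \<epsilon> \<Longrightarrow> Q o\<^sub>L Q = Q \<Longrightarrow>
        positive_definite_on (range (blinfun_apply Q)) (\<lambda>u. inner (A u) u)"
      using positive_definite_range_open[OF sym fd] by (auto simp: G_def)
    obtain \<delta> where "\<delta> > 0" "\<And>y. y \<in> I \<Longrightarrow> dist y x < \<delta> \<Longrightarrow> dist (P y) (P x) < \<epsilon>"
      using cont x \<epsilon>(1) unfolding continuous_on_iff G_def by blast
    then show "\<exists>e>0. \<forall>x'\<in>I. dist x' x < e \<longrightarrow> x' \<in> G"
      using \<epsilon>(2) idem by (auto simp: G_def dist_norm)
  qed (auto simp: G_def)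
  moreover have "closedin (top_of_set I) G"
    unfolding closedin_limpt
  proof (intro conjI allI impI)
    fix x assume x: "x islimpt G \<and> x \<in> I"
    then obtain f where f: "\<And>n. f n \<in> G - {x}" "f \<longlonglongrightarrow> x" unfolding islimpt_sequential by blast
    have "(\<lambda>n. P (f n)) \<longlonglongrightarrow> P x"
      using f x by (intro continuous_on_tendsto_compose[OF cont]) (auto simp: G_def)
    then have "?pos x"
      using f(1) x idem Psym by (rule_tac positive_definite_range_limit[OF sym inj, of "\<lambda>n. P (f n)"]) (auto simp: G_def)
    then show "x \<in> G" using x by (simp add: G_def)
  qed (auto simp: G_def)
  ultimately have "G = I" using \<open>connected I\<close> s0 unfolding connected_clopen by (auto simp: G_def)
  then show ?thesis using \<open>s \<in> I\<close> by (auto simp: G_def)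
qed

section \<open>Resolvents\<close>

definition complex_linear :: "('a::complex_inner \<Rightarrow>\<^sub>L 'a) \<Rightarrow> bool"
  where "complex_linear A \<longleftrightarrow> (\<forall>c u. A (c *\<^sub>C u) = c *\<^sub>C A u)"

lemma converse_eq_graph_iff:
  "T\<inverse> = bounded_operator_graph B \<longleftrightarrow> (\<forall>u v. (u, v) \<in> T \<longleftrightarrow> u = B v)"
  unfolding bounded_operator_graph_def by (auto simp: set_eq_iff)

lemma bounded_operator_graph_inject:
  "bounded_operator_graph A = bounded_operator_graph B \<longleftrightarrow> A = B"
proof
  assume eq: "bounded_operator_graph A = bounded_operator_graph B"
  have "(u, A u) \<in> bounded_operator_graph A" for u by (auto simp: bounded_operator_graph_def)
  then have "(u, A u) \<in> bounded_operator_graph B" for u using eq by simp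
  then show "A = B" by (auto simp: bounded_operator_graph_def intro: blinfun_eqI)
qed simp

lemma resolvent_eqI:
  assumes "(shifted \<xi> T)\<inverse> = bounded_operator_graph R"
  shows "\<xi> \<in> resolvent_set T" "resolvent T \<xi> = R"
  using assms unfolding resolvent_set_def has_bounded_inverse_def resolvent_def
  by (auto simp: bounded_operator_graph_inject)

lemma resolvent_converse:
  assumes "\<xi> \<in> resolvent_set T"
  shows "(shifted \<xi> T)\<inverse> = bounded_operator_graph (resolvent T \<xi>)"
  using assms resolvent_eqI(2) unfolding resolvent_set_def has_bounded_inverse_def by blast

lemma shifted_iff: "(u, w) \<in> shifted \<xi> T \<longleftrightarrow> (u, \<xi> *\<^sub>C u - w) \<in> T"
proof -
  have "w = \<xi> *\<^sub>C u - (\<xi> *\<^sub>C u - w)" by simp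
  then show ?thesis unfolding shifted_def by fastforce
qed

text \<open>Injectivity, surjectivity and the value of the inverse in a single equivalence; with its
  converse \<open>resolvent_memI\<close> it replaces calculations with inverse graphs.\<close>

lemma resolvent_iff:
  assumes "\<xi> \<in> resolvent_set T"
  shows "(u, \<xi> *\<^sub>C u - w) \<in> T \<longleftrightarrow> u = resolvent T \<xi> w"
  using resolvent_converse[OF assms] by (simp add: converse_eq_graph_iff shifted_iff)

lemma resolvent_memI:
  assumes "\<And>u w. (u, \<xi> *\<^sub>C u - w) \<in> T \<longleftrightarrow> u = blinfun_apply R w"
  shows "\<xi> \<in> resolvent_set T" "resolvent T \<xi> = R"
  using resolvent_eqI[of \<xi> T R] assms by (auto simp: converse_eq_graph_iff shifted_iff)

lemma resolvent_graph:
  assumes "\<xi> \<in> resolvent_set T"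
  shows "(resolvent T \<xi> w, \<xi> *\<^sub>C resolvent T \<xi> w - w) \<in> T"
  using resolvent_iff[OF assms] by blast

lemma complex_linear_resolvent:
  assumes "linear_operator T" "\<xi> \<in> resolvent_set T"
  shows "complex_linear (resolvent T \<xi>)"
  unfolding complex_linear_def
proof (intro allI)
  fix c w
  have "(c *\<^sub>C resolvent T \<xi> w, c *\<^sub>C (\<xi> *\<^sub>C resolvent T \<xi> w - w)) \<in> T"
    using resolvent_graph[OF assms(2)] assms(1) unfolding linear_operator_def by blast
  then have "(c *\<^sub>C resolvent T \<xi> w, \<xi> *\<^sub>C (c *\<^sub>C resolvent T \<xi> w) - c *\<^sub>C w) \<in> T"
    by (simp add: scaleC.diff_right scaleC_scaleC mult.commute)
  then show "resolvent T \<xi> (c *\<^sub>C w) = c *\<^sub>C resolvent T \<xi> w"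
    by (simp add: resolvent_iff[OF assms(2)])
qed

lemma resolvent_left_inverse:
  assumes "\<xi> \<in> resolvent_set T" "(u, v) \<in> T"
  shows "resolvent T \<xi> (\<xi> *\<^sub>C u - v) = u"
  using resolvent_iff[OF assms(1), of u "\<xi> *\<^sub>C u - v"] assms(2) by simp

text \<open>On the vector \<open>resolvent T \<eta> w\<close> the operator \<open>\<xi> - T\<close>
  gives \<open>w - (\<eta> - \<xi>) *\<^sub>C resolvent T \<eta> w\<close>; now apply the left
  inverse at \<open>\<xi>\<close>.\<close>

lemma resolvent_identity:
  assumes "\<xi> \<in> resolvent_set T" "\<eta> \<in> resolvent_set T" "linear_operator T"
  shows "resolvent T \<xi> w - resolvent T \<eta> w = (\<eta> - \<xi>) *\<^sub>C resolvent T \<xi> (resolvent T \<eta> w)"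
proof -
  let ?u = "resolvent T \<eta> w"
  have "?u = resolvent T \<xi> (\<xi> *\<^sub>C ?u - (\<eta> *\<^sub>C ?u - w))"
    by (rule resolvent_left_inverse[OF assms(1) resolvent_graph[OF assms(2)], symmetric])
  also have "\<xi> *\<^sub>C ?u - (\<eta> *\<^sub>C ?u - w) = w - (\<eta> - \<xi>) *\<^sub>C ?u"
    by (simp add: scaleC.diff_left)
  also have "resolvent T \<xi> (w - (\<eta> - \<xi>) *\<^sub>C ?u) = resolvent T \<xi> w - (\<eta> - \<xi>) *\<^sub>C resolvent T \<xi> ?u"
    using complex_linear_resolvent[OF assms(3,1)] by (simp add: complex_linear_def blinfun.bilinear_simps)
  finally show ?thesis by (simp add: algebra_simps)
qed

text \<open>The Neumann series is replaced by the contraction \<open>u \<mapsto> w - (\<xi> - \<eta>) R(\<eta>) u\<close>.\<close>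

lemma resolvent_set_ball:
  fixes T :: "'a::chilbert_space graph"
  assumes T: "linear_operator T" and \<eta>: "\<eta> \<in> resolvent_set T"
    and M: "norm (resolvent T \<eta>) \<le> M" and near: "cmod (\<xi> - \<eta>) * M \<le> 1 / 2"
  shows "\<xi> \<in> resolvent_set T" and "norm (resolvent T \<xi>) \<le> 2 * M"
proof -
  let ?R = "resolvent T \<eta>"
  define a where "a = \<xi> - \<eta>"
  have M0: "M \<ge> 0" using norm_ge_zero[of ?R] M by (rule order_trans)
  have Rlin: "?R (c *\<^sub>C w) = c *\<^sub>C ?R w" for c w
    using complex_linear_resolvent[OF T \<eta>] by (simp add: complex_linear_def)
  have small: "norm (a *\<^sub>C ?R u) \<le> norm u / 2" for u
  proof -
    have "norm (a *\<^sub>C ?R u) \<le> cmod a * (M * norm u)"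
      unfolding norm_scaleC
      by (intro mult_left_mono order_trans[OF norm_blinfun] mult_right_mono M) auto
    also have "\<dots> \<le> 1 / 2 * norm u"
      using mult_right_mono[OF near, of "norm u"] by (simp add: a_def mult.assoc)
    finally show ?thesis by simp
  qed
  have ex: "\<exists>!u. w - a *\<^sub>C ?R u = u" for w
  proof -
    have "dist (w - a *\<^sub>C ?R x) (w - a *\<^sub>C ?R y) \<le> 1/2 * dist x y" for x y
      using small[of "y - x"]
      by (simp add: dist_norm blinfun.diff_right scaleC.diff_right norm_minus_commute)
    then show ?thesis by (intro banach_fix_type[of "1/2"]) auto
  qed
  \<comment> \<open>\<open>N\<close> inverts \<open>1 + a R(\<eta>)\<close>. Uniqueness of the fixed
    point makes it linear, and the contraction factor 1/2 bounds it by 2, so that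
    \<open>R(\<eta>) N\<close> is the resolvent at \<open>\<xi>\<close>.\<close>
  define N where "N w = (THE u. w - a *\<^sub>C ?R u = u)" for w
  have N: "w - a *\<^sub>C ?R (N w) = N w" for w
    unfolding N_def using theI'[OF ex[of w]] .
  have Nu: "u = N w" if "w - a *\<^sub>C ?R u = u" for u w
    using ex[of w] N[of w] that by blast
  have add: "N (w + w') = N w + N w'" for w w'
  proof (rule Nu[symmetric])
    have "w + w' - a *\<^sub>C ?R (N w + N w') = (w - a *\<^sub>C ?R (N w)) + (w' - a *\<^sub>C ?R (N w'))"
      by (simp add: blinfun.add_right scaleC.add_right)
    then show "w + w' - a *\<^sub>C ?R (N w + N w') = N w + N w'" unfolding N .
  qed
  have scl: "N (c *\<^sub>C w) = c *\<^sub>C N w" for c w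
  proof (rule Nu[symmetric])
    have "c *\<^sub>C w - a *\<^sub>C ?R (c *\<^sub>C N w) = c *\<^sub>C (w - a *\<^sub>C ?R (N w))"
      by (simp add: Rlin scaleC.diff_right scaleC_scaleC mult.commute)
    then show "c *\<^sub>C w - a *\<^sub>C ?R (c *\<^sub>C N w) = c *\<^sub>C N w" unfolding N .
  qed
  have bnd: "norm (N w) \<le> 2 * norm w" for w
  proof -
    have "norm (N w) \<le> norm w + norm (a *\<^sub>C ?R (N w))"
      by (subst (1) N[symmetric]) (rule norm_triangle_ineq4)
    then show ?thesis using small[of "N w"] by simp
  qed
  have bl: "bounded_linear (\<lambda>w. ?R (N w))"
  proof (rule bounded_linear_intro[where K = "2 * M"])
    show "norm (?R (N x)) \<le> norm x * (2 * M)" for x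
    proof -
      have "norm (?R (N x)) \<le> M * (2 * norm x)"
        by (intro order_trans[OF norm_blinfun] mult_mono M bnd) (use M0 in auto)
      then show ?thesis by (simp add: mult_ac)
    qed
    show "?R (N (x + y)) = ?R (N x) + ?R (N y)" for x y by (simp add: add blinfun.add_right)
    show "?R (N (r *\<^sub>R x)) = r *\<^sub>R ?R (N x)" for r x
      by (simp only: scaleR_scaleC scl Rlin)
  qed
  define R' where "R' = Blinfun (\<lambda>w. ?R (N w))"
  have R': "R' w = ?R (N w)" for w unfolding R'_def using bl by (simp add: bounded_linear_Blinfun_apply)
  have "(u, \<xi> *\<^sub>C u - w) \<in> T \<longleftrightarrow> u = R' w" for u w
  proof -
    have "(u, \<xi> *\<^sub>C u - w) \<in> T \<longleftrightarrow> (u, \<eta> *\<^sub>C u - (w - a *\<^sub>C u)) \<in> T"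
      by (simp add: a_def scaleC.diff_left algebra_simps)
    also have "\<dots> \<longleftrightarrow> u = ?R (w - a *\<^sub>C u)" by (rule resolvent_iff[OF \<eta>])
    \<comment> \<open>The unknown changes from \<open>u\<close> to \<open>w - a *\<^sub>C u\<close>,
      which is a fixed point of the contraction exactly when the equation for \<open>u\<close>
      holds.\<close>
    also have "\<dots> \<longleftrightarrow> u = ?R (N w)"
    proof
      assume u: "u = ?R (w - a *\<^sub>C u)"
      then have "w - a *\<^sub>C ?R (w - a *\<^sub>C u) = w - a *\<^sub>C u" by simp
      then have "w - a *\<^sub>C u = N w" by (rule Nu)
      then show "u = ?R (N w)" using u by simp
    next
      assume "u = ?R (N w)"
      then show "u = ?R (w - a *\<^sub>C u)" using N[of w] by simp
    qed
    finally show ?thesis by (simp add: R')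
  qed
  from resolvent_memI[OF this] have *: "\<xi> \<in> resolvent_set T" "resolvent T \<xi> = R'" .
  show "\<xi> \<in> resolvent_set T" by fact
  show "norm (resolvent T \<xi>) \<le> 2 * M"
    unfolding *(2)
  proof (rule norm_blinfun_bound)
    show "norm (R' x) \<le> 2 * M * norm x" for x
    proof -
      have "norm (?R (N x)) \<le> M * (2 * norm x)"
        by (intro order_trans[OF norm_blinfun] mult_mono M bnd) (use M0 in auto)
      then show ?thesis by (simp add: R' mult_ac)
    qed
  qed (use M0 in auto)
qed

section \<open>Openness of the resolvent set; continuity and holomorphy of the resolvent\<close>

lemma open_resolvent_set:
  fixes T :: "'a::chilbert_space graph"
  assumes T: "linear_operator T"
  shows "open (resolvent_set T)"
  unfolding open_dist
proof (intro ballI)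
  fix \<eta> assume \<eta>: "\<eta> \<in> resolvent_set T"
  \<comment> \<open>The \<open>+ 1\<close> keeps \<open>M\<close> positive even on the zero space,
    where the resolvent vanishes.\<close>
  define M where "M = norm (resolvent T \<eta>) + 1"
  have "M > 0" unfolding M_def by (simp add: add_nonneg_pos)
  have "\<xi> \<in> resolvent_set T" if "dist \<xi> \<eta> < 1 / (2 * M)" for \<xi>
    using that \<open>M > 0\<close>
    by (intro resolvent_set_ball(1)[OF T \<eta>, of M]) (auto simp: M_def dist_norm field_simps)
  then show "\<exists>e>0. \<forall>y. dist y \<eta> < e \<longrightarrow> y \<in> resolvent_set T"
    using \<open>M > 0\<close> by (intro exI[of _ "1 / (2 * M)"]) auto
qed

lemma resolvent_lipschitz:
  fixes T :: "'a::chilbert_space graph"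
  assumes T: "linear_operator T" and "\<xi> \<in> resolvent_set T" "\<eta> \<in> resolvent_set T"
  shows "norm (resolvent T \<xi> - resolvent T \<eta>) \<le>
    cmod (\<eta> - \<xi>) * (norm (resolvent T \<xi>) * norm (resolvent T \<eta>))"
proof -
  have "resolvent T \<xi> - resolvent T \<eta> = scaleC_blinfun (\<eta> - \<xi>) (resolvent T \<xi> o\<^sub>L resolvent T \<eta>)"
    by (rule blinfun_eqI) (simp add: blinfun.diff_left resolvent_identity[OF assms(2,3,1)])
  then have "norm (resolvent T \<xi> - resolvent T \<eta>) \<le> cmod (\<eta> - \<xi>) * norm (resolvent T \<xi> o\<^sub>L resolvent T \<eta>)"
    by (simp add: norm_scaleC_blinfun)
  also have "\<dots> \<le> cmod (\<eta> - \<xi>) * (norm (resolvent T \<xi>) * norm (resolvent T \<eta>))"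
    by (intro mult_left_mono norm_blinfun_compose) auto
  finally show ?thesis .
qed

lemma continuous_on_resolvent:
  fixes T :: "'a::chilbert_space graph"
  assumes T: "linear_operator T"
  shows "continuous_on (resolvent_set T) (resolvent T)"
  unfolding continuous_on_eq_continuous_at[OF open_resolvent_set[OF T]]
proof
  fix \<eta> assume \<eta>: "\<eta> \<in> resolvent_set T"
  define M where "M = norm (resolvent T \<eta>) + 1"
  have "M > 0" unfolding M_def by (simp add: add_nonneg_pos)
  have ev: "\<forall>\<^sub>F \<xi> in at \<eta>. norm (resolvent T \<xi> - resolvent T \<eta>) \<le> cmod (\<eta> - \<xi>) * (2 * M * M)"
    unfolding eventually_at
  proof (intro exI[of _ "1 / (2 * M)"] conjI ballI impI)
    fix \<xi> assume "\<xi> \<noteq> \<eta> \<and> dist \<xi> \<eta> < 1 / (2 * M)"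
    then have near: "cmod (\<xi> - \<eta>) * M \<le> 1 / 2" using \<open>M > 0\<close> by (auto simp: dist_norm field_simps)
    note b = resolvent_set_ball[OF T \<eta> _ near]
    have "norm (resolvent T \<eta>) \<le> M" by (simp add: M_def)
    note b = b[OF this]
    have "norm (resolvent T \<xi>) * norm (resolvent T \<eta>) \<le> 2 * M * M"
      using b(2) \<open>M > 0\<close> \<open>norm (resolvent T \<eta>) \<le> M\<close> by (intro mult_mono) auto
    then show "norm (resolvent T \<xi> - resolvent T \<eta>) \<le> cmod (\<eta> - \<xi>) * (2 * M * M)"
      using resolvent_lipschitz[OF T b(1) \<eta>] by (meson mult_left_mono norm_ge_zero order_trans)
  qed (use \<open>M > 0\<close> in auto)
  have "((\<lambda>\<xi>. cmod (\<eta> - \<xi>) * (2 * M * M)) \<longlongrightarrow> cmod (\<eta> - \<eta>) * (2 * M * M)) (at \<eta>)"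
    by (intro tendsto_intros)
  then have "((\<lambda>\<xi>. cmod (\<eta> - \<xi>) * (2 * M * M)) \<longlongrightarrow> 0) (at \<eta>)" by simp
  with ev have "((\<lambda>\<xi>. resolvent T \<xi> - resolvent T \<eta>) \<longlongrightarrow> 0) (at \<eta>)"
    by (rule Lim_null_comparison)
  then show "isCont (resolvent T) \<eta>"
    by (simp add: isCont_def LIM_zero_iff)
qed

text \<open>A combination of a strong and a weak condition: norm continuity makes operator-valued
  integrals and norm derivatives available, while holomorphy of the matrix elements is enough to
  import Cauchy's theorem for scalar functions.\<close>

definition weakly_holomorphic_on :: "(complex \<Rightarrow> ('a::complex_inner \<Rightarrow>\<^sub>L 'a)) \<Rightarrow> complex set \<Rightarrow> bool"
    (infixl \<open>weakly'_holomorphic'_on\<close> 50)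
  where "f weakly_holomorphic_on U \<longleftrightarrow>
    continuous_on U f \<and> (\<forall>u v. (\<lambda>\<xi>. cinner (f \<xi> u) v) holomorphic_on U)"

lemma weakly_holomorphic_on_subset:
  "f weakly_holomorphic_on U \<Longrightarrow> V \<subseteq> U \<Longrightarrow> f weakly_holomorphic_on V"
  unfolding weakly_holomorphic_on_def using continuous_on_subset holomorphic_on_subset by blast

lemma weakly_holomorphic_on_diff:
  "f weakly_holomorphic_on U \<Longrightarrow> g weakly_holomorphic_on U \<Longrightarrow> (\<lambda>\<xi>. f \<xi> - g \<xi>) weakly_holomorphic_on U"
  unfolding weakly_holomorphic_on_def
  by (auto simp: blinfun.diff_left cinner.diff_left intro!: continuous_intros holomorphic_intros)

text \<open>By the resolvent identity the difference quotient at \<open>\<eta>\<close> equals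
  \<open>- cinner (R \<xi> (R \<eta> u)) v\<close>, so continuity of the resolvent already yields
  the derivative.\<close>

lemma weakly_holomorphic_resolvent:
  fixes T :: "'a::chilbert_space graph"
  assumes T: "linear_operator T"
  shows "resolvent T weakly_holomorphic_on resolvent_set T"
  unfolding weakly_holomorphic_on_def
proof (intro conjI allI)
  show "continuous_on (resolvent_set T) (resolvent T)" by (rule continuous_on_resolvent[OF T])
  fix u v
  let ?R = "resolvent T"
  show "(\<lambda>\<xi>. cinner (?R \<xi> u) v) holomorphic_on resolvent_set T"
    unfolding holomorphic_on_open[OF open_resolvent_set[OF T]]
  proof (intro ballI allI impI)
    fix \<eta> assume \<eta>: "\<eta> \<in> resolvent_set T"
    have cont: "isCont ?R \<eta>"
      using continuous_on_resolvent[OF T] \<eta> open_resolvent_set[OF T] continuous_on_eq_continuous_at by blast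
    have "((\<lambda>\<xi>. - cinner (?R \<xi> (?R \<eta> u)) v) \<longlongrightarrow> - cinner (?R \<eta> (?R \<eta> u)) v) (at \<eta>)"
      using cont unfolding isCont_def
      by (intro tendsto_minus cinner.tendsto blinfun.tendsto tendsto_const)
    moreover have "\<forall>\<^sub>F \<xi> in at \<eta>. - cinner (?R \<xi> (?R \<eta> u)) v =
        (cinner (?R \<xi> u) v - cinner (?R \<eta> u) v) / (\<xi> - \<eta>)"
      unfolding eventually_at_topological
    proof (intro exI conjI ballI impI)
      fix \<xi> assume \<xi>: "\<xi> \<in> resolvent_set T" "\<xi> \<noteq> \<eta>"
      have "cinner (?R \<xi> u) v - cinner (?R \<eta> u) v = (\<eta> - \<xi>) * cinner (?R \<xi> (?R \<eta> u)) v"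
        unfolding cinner.diff_left[symmetric] resolvent_identity[OF \<xi>(1) \<eta> T] cinner_scaleC_left ..
      then show "- cinner (?R \<xi> (?R \<eta> u)) v = (cinner (?R \<xi> u) v - cinner (?R \<eta> u) v) / (\<xi> - \<eta>)"
        using \<xi>(2) by (simp add: field_simps)
    qed (use open_resolvent_set[OF T] \<eta> in auto)
    ultimately have "((\<lambda>\<xi>. cinner (?R \<xi> u) v) has_field_derivative - cinner (?R \<eta> (?R \<eta> u)) v) (at \<eta>)"
      unfolding has_field_derivative_iff by (rule Lim_transform_eventually)
    then show "\<exists>f'. ((\<lambda>\<xi>. cinner (?R \<xi> u) v) has_field_derivative f') (at \<eta>)" by blast
  qed
qed

section \<open>Operator-valued contour integrals\<close>

lemma bounded_linear_cinner_apply: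
  "bounded_linear (\<lambda>A :: 'a::complex_inner \<Rightarrow>\<^sub>L 'a. cinner (A u) v)"
  by (intro bounded_linear_compose[OF cinner.bounded_linear_left] blinfun.bounded_linear_left)

lemma blinfun_cinner_ext:
  fixes A B :: "'a::complex_inner \<Rightarrow>\<^sub>L 'a"
  assumes "\<And>u v. cinner (A u) v = cinner (B u) v"
  shows "A = B"
  by (rule blinfun_eqI, rule cinner_ext, rule assms)

lemma integral_linepath_cinner:
  fixes f :: "complex \<Rightarrow> 'a::chilbert_space \<Rightarrow>\<^sub>L 'a"
  assumes "continuous_on (closed_segment x y) f"
  shows "(\<lambda>t. scaleC_blinfun (y - x) (f (linepath x y t))) integrable_on {0..1}"
    and "cinner (integral {0..1} (\<lambda>t. scaleC_blinfun (y - x) (f (linepath x y t))) u) v =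
      contour_integral (linepath x y) (\<lambda>\<xi>. cinner (f \<xi> u) v)"
proof -
  let ?g = "\<lambda>t. scaleC_blinfun (y - x) (f (linepath x y t))"
  have "continuous_on {0..1} (\<lambda>t. f (linepath x y t))"
    by (rule continuous_on_compose2[OF assms]) (auto simp: linepath_image_01[symmetric] intro: continuous_on_linepath)
  then show int: "?g integrable_on {0..1}"
    by (intro integrable_continuous_interval scaleCb.continuous_on continuous_on_const)
  have "cinner (integral {0..1} ?g u) v = integral {0..1} ((\<lambda>A. cinner (blinfun_apply A u) v) \<circ> ?g)"
    by (rule integral_linear[OF int bounded_linear_cinner_apply, symmetric])
  also have "\<dots> = contour_integral (linepath x y) (\<lambda>\<xi>. cinner (f \<xi> u) v)"
    by (simp add: contour_integral_integral o_def cinner_scaleC_left mult.commute)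
  finally show "cinner (integral {0..1} ?g u) v = contour_integral (linepath x y) (\<lambda>\<xi>. cinner (f \<xi> u) v)" .
qed

text \<open>Integrate along segments from a base point. Cauchy's theorem on triangles, applied to
  each matrix element, gives additivity of these integrals as an identity of operators; norm
  continuity of \<open>f\<close> then makes the derivative a norm derivative and not merely a weak
  one.\<close>

lemma weakly_holomorphic_primitive:
  fixes f :: "complex \<Rightarrow> 'a::chilbert_space \<Rightarrow>\<^sub>L 'a"
  assumes f: "f weakly_holomorphic_on U" and U: "open U" "convex U"
  obtains F where "\<And>x. x \<in> U \<Longrightarrow> (F has_derivative (\<lambda>h. scaleC_blinfun h (f x))) (at x)"
proof (cases "U = {}")
  case True
  then show ?thesis using that by blast
next
  case False
  then obtain c where c: "c \<in> U" by blast
  define G where "G x y = integral {0..1} (\<lambda>t. scaleC_blinfun (y - x) (f (linepath x y t)))" for x y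
  have cont: "continuous_on (closed_segment x y) f" if "x \<in> U" "y \<in> U" for x y
    using f closed_segment_subset[OF that U(2)] unfolding weakly_holomorphic_on_def
    by (blast intro: continuous_on_subset)
  have G: "G c y - G c x = G x y" if xy: "x \<in> U" "y \<in> U" for x y
  proof (rule blinfun_cinner_ext)
    fix u v
    let ?h = "\<lambda>\<xi>. cinner (f \<xi> u) v"
    have hol: "?h holomorphic_on U" using f by (simp add: weakly_holomorphic_on_def)
    have "convex hull {c, x, y} \<subseteq> U" using U(2) c xy by (simp add: subset_hull)
    then have "(?h has_contour_integral 0) (linepath c x +++ linepath x y +++ linepath y c)"
      using hol by (intro Cauchy_theorem_triangle) (rule holomorphic_on_subset)
    then have "contour_integral (linepath c x) ?h + contour_integral (linepath x y) ?h
        + contour_integral (linepath y c) ?h = 0"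
      by (rule has_chain_integral_chain_integral3)
    moreover have "contour_integral (linepath y c) ?h = - contour_integral (linepath c y) ?h"
      using hol c xy closed_segment_subset[OF xy(2) c U(2)]
      by (intro contour_integral_reverse_linepath)
        (auto intro: holomorphic_on_imp_continuous_on continuous_on_subset)
    ultimately show "cinner ((G c y - G c x) u) v = cinner (G x y u) v"
      unfolding blinfun.diff_left cinner.diff_left G_def
      using c xy by (simp add: integral_linepath_cinner(2) cont diff_eq_eq add.commute)
  qed
  have "(G c has_derivative (\<lambda>h. scaleC_blinfun h (f x))) (at x)" if x: "x \<in> U" for x
    unfolding has_derivative_at_alt
  proof (intro conjI allI impI)
    show "bounded_linear (\<lambda>h. scaleC_blinfun h (f x))" by (rule scaleCb.bounded_linear_left)
    fix e :: real assume e: "e > 0"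
    have "isCont f x" using f U x unfolding weakly_holomorphic_on_def by (simp add: continuous_on_eq_continuous_at)
    then obtain d1 where d1: "d1 > 0" "\<And>y. dist y x < d1 \<Longrightarrow> dist (f y) (f x) < e"
      using e unfolding continuous_at by (metis (no_types, lifting) LIM_def dist_self)
    obtain d2 where d2: "d2 > 0" "ball x d2 \<subseteq> U" using U x openE by blast
    show "\<exists>d>0. \<forall>y. norm (y - x) < d \<longrightarrow>
        norm (G c y - G c x - scaleC_blinfun (y - x) (f x)) \<le> e * norm (y - x)"
    proof (intro exI[of _ "min d1 d2"] conjI allI impI)
      show "min d1 d2 > 0" using d1 d2 by simp
      fix y assume "norm (y - x) < min d1 d2"
      then have y: "dist y x < d1" "dist y x < d2" by (auto simp: dist_norm)
      have yU: "y \<in> U" using y d2 by (auto simp: dist_commute)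
      let ?g = "\<lambda>t. scaleC_blinfun (y - x) (f (linepath x y t))"
      have "(?g has_integral G x y) {0..1}"
        unfolding G_def by (intro integrable_integral integral_linepath_cinner(1) cont x yU)
      moreover have "((\<lambda>t::real. scaleC_blinfun (y - x) (f x)) has_integral scaleC_blinfun (y - x) (f x)) {0..1}"
        using has_integral_const_real[of "scaleC_blinfun (y - x) (f x)" 0 1] by simp
      ultimately have "((\<lambda>t. ?g t - scaleC_blinfun (y - x) (f x)) has_integral
          G x y - scaleC_blinfun (y - x) (f x)) {0..1}"
        by (rule has_integral_diff)
      moreover have "norm (?g t - scaleC_blinfun (y - x) (f x)) \<le> e * norm (y - x)" if t: "t \<in> {0..1}" for t
      proof -
        have "linepath x y t \<in> ball x d1"
          using closed_segment_subset[of x "ball x d1" y] y d1(1) t linepath_in_path[of t x y]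
          by (auto simp: dist_commute)
        then have "norm (f (linepath x y t) - f x) \<le> e"
          using d1(2)[of "linepath x y t"] by (auto simp: dist_norm norm_minus_commute dist_commute)
        then have "norm (scaleC_blinfun (y - x) (f (linepath x y t) - f x)) \<le> norm (y - x) * e"
          by (intro order_trans[OF norm_scaleC_blinfun] mult_left_mono) auto
        then show ?thesis by (simp add: scaleCb.diff_right mult.commute)
      qed
      ultimately have "norm (G x y - scaleC_blinfun (y - x) (f x)) \<le> e * norm (y - x) * measure lborel {0..1::real}"
        using e by (intro has_integral_bound_real[where f = "\<lambda>t. ?g t - scaleC_blinfun (y - x) (f x)"]) auto
      then show "norm (G c y - G c x - scaleC_blinfun (y - x) (f x)) \<le> e * norm (y - x)"
        using G[OF x yU] by simp
    qed
  qed
  then show ?thesis using that by blast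
qed

text \<open>With a primitive, the fundamental theorem of calculus with finitely many exceptional
  points gives integrability even if \<open>\<gamma>'\<close> is unbounded near \<open>D\<close>.
  The mean value inequality for the primitive estimates by the distance of the end points,
  independently of the length.\<close>

lemma path_piece_integral:
  fixes f :: "complex \<Rightarrow> 'a::chilbert_space \<Rightarrow>\<^sub>L 'a"
  assumes f: "f weakly_holomorphic_on U" and U: "open U" "convex U"
    and bound: "\<And>x. x \<in> U \<Longrightarrow> norm (f x) \<le> \<epsilon>"
    and \<gamma>: "continuous_on {a..b} \<gamma>" "a \<le> b" "\<gamma> ` {a..b} \<subseteq> U" "finite D"
      "\<And>t. t \<in> {a<..<b} - D \<Longrightarrow> (\<gamma> has_vector_derivative \<gamma>' t) (at t)"
  obtains i where "((\<lambda>t. scaleC_blinfun (\<gamma>' t) (f (\<gamma> t))) has_integral i) {a..b}"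
    "norm i \<le> \<epsilon> * dist (\<gamma> a) (\<gamma> b)"
proof -
  obtain F where F: "\<And>x. x \<in> U \<Longrightarrow> (F has_derivative (\<lambda>h. scaleC_blinfun h (f x))) (at x)"
    using weakly_holomorphic_primitive[OF f U] by blast
  have ab: "\<gamma> a \<in> U" "\<gamma> b \<in> U" using \<gamma> by auto
  have "((\<lambda>t. scaleC_blinfun (\<gamma>' t) (f (\<gamma> t))) has_integral (F (\<gamma> b) - F (\<gamma> a))) {a..b}"
  proof (rule fundamental_theorem_of_calculus_interior_strong[OF \<gamma>(4,2)])
    fix t assume t: "t \<in> {a<..<b} - D"
    have "\<gamma> t \<in> U" using t \<gamma>(3) by auto
    show "((\<lambda>t. F (\<gamma> t)) has_vector_derivative scaleC_blinfun (\<gamma>' t) (f (\<gamma> t))) (at t)"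
      unfolding has_vector_derivative_def
      using has_derivative_compose[OF \<gamma>(5)[OF t, unfolded has_vector_derivative_def] F[OF \<open>\<gamma> t \<in> U\<close>]]
      by (simp add: scaleCb.scaleR_left)
  next
    have "continuous_on U F"
      using F by (meson continuous_at_imp_continuous_on has_derivative_continuous)
    then show "continuous_on {a..b} (\<lambda>t. F (\<gamma> t))"
      by (rule continuous_on_compose2[OF _ \<gamma>(1,3)])
  qed
  moreover have "norm (F (\<gamma> b) - F (\<gamma> a)) \<le> \<epsilon> * norm (\<gamma> b - \<gamma> a)"
  proof (rule differentiable_bound[OF U(2) _ _ ab(2,1)])
    show "(F has_derivative (\<lambda>h. scaleC_blinfun h (f x))) (at x within U)" if "x \<in> U" for x
      using F[OF that] by (rule has_derivative_at_withinI)
    show "onorm (\<lambda>h. scaleC_blinfun h (f x)) \<le> \<epsilon>" if "x \<in> U" for x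
    proof (rule onorm_bound)
      show "0 \<le> \<epsilon>" using bound[OF that] norm_ge_zero order_trans by blast
      show "norm (scaleC_blinfun h (f x)) \<le> \<epsilon> * norm h" for h
        using norm_scaleC_blinfun[of h "f x"] mult_left_mono[OF bound[OF that], of "cmod h"]
        by (simp add: mult.commute)
    qed
  qed
  ultimately show ?thesis using that by (simp add: dist_norm norm_minus_commute)
qed

abbreviation blinfun_contour_integrand ::
    "(real \<Rightarrow> complex) \<Rightarrow> (complex \<Rightarrow> 'a::complex_inner \<Rightarrow>\<^sub>L 'a) \<Rightarrow> real \<Rightarrow> ('a \<Rightarrow>\<^sub>L 'a)"
  where "blinfun_contour_integrand \<gamma> f \<equiv>
    \<lambda>t. scaleC_blinfun (vector_derivative \<gamma> (at t within {0..1})) (f (\<gamma> t))"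

text \<open>A \<^const>\<open>valid_path\<close> may have infinite length, so the bound is obtained from local primitives
  on \<open>n\<close> balls that cover the path, rather than from the length.\<close>

lemma path_integral_bound:
  fixes f :: "complex \<Rightarrow> 'a::chilbert_space \<Rightarrow>\<^sub>L 'a"
  assumes f: "f weakly_holomorphic_on U"
    and bound: "\<And>x. x \<in> U \<Longrightarrow> norm (f x) \<le> \<epsilon>"
    and \<gamma>: "valid_path \<gamma>" and nhd: "\<And>t. t \<in> {0..1} \<Longrightarrow> ball (\<gamma> t) r \<subseteq> U"
    and n: "n > 0" and fine: "\<And>s t. s \<in> {0..1} \<Longrightarrow> t \<in> {0..1} \<Longrightarrow> \<bar>s - t\<bar> \<le> 1 / real n \<Longrightarrow> dist (\<gamma> s) (\<gamma> t) < r"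
  shows "blinfun_contour_integrand \<gamma> f integrable_on {0..1}"
    and "norm (integral {0..1} (blinfun_contour_integrand \<gamma> f)) \<le> real n * (\<epsilon> * r)"
proof -
  let ?g = "blinfun_contour_integrand \<gamma> f"
  obtain D where D: "finite D" "\<gamma> C1_differentiable_on {0..1} - D" and cont: "continuous_on {0..1} \<gamma>"
    using \<gamma> unfolding valid_path_def piecewise_C1_differentiable_on_def by blast
  have der: "(\<gamma> has_vector_derivative vector_derivative \<gamma> (at t within {0..1})) (at t)"
    if t: "t \<in> {0<..<1} - D" for t
  proof -
    have "at t within {0..1} = at t" using t by (intro at_within_interior) auto
    moreover have "\<gamma> differentiable at t" using D(2) t by (auto simp: C1_differentiable_on_eq)
    ultimately show ?thesis by (simp add: vector_derivative_works)
  qed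
  have r: "r > 0" using fine[of 0 0] by simp
  have "\<gamma> 0 \<in> U" using nhd[of 0] r by auto
  then have \<epsilon>: "\<epsilon> \<ge> 0" using bound norm_ge_zero order_trans by blast
  \<comment> \<open>Each of the \<open>n\<close> pieces stays in the \<open>r\<close>-ball around
    its initial point, where a primitive exists, and contributes at most
    \<open>\<epsilon> * r\<close>.\<close>
  have "\<exists>i. (?g has_integral i) {0..real k / n} \<and> norm i \<le> real k * (\<epsilon> * r)" if "k \<le> n" for k
    using that
  proof (induction k)
    case 0
    show ?case by (intro exI[of _ 0]) auto
  next
    case (Suc k)
    then obtain i where i: "(?g has_integral i) {0..real k / n}" "norm i \<le> real k * (\<epsilon> * r)" by auto
    define a where "a = real k / n"
    define b where "b = real (Suc k) / n"
    have ab: "0 \<le> a" "a \<le> b" "b \<le> 1" "b - a = 1 / n"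
      using Suc.prems n by (auto simp: a_def b_def field_simps)
    have near: "dist (\<gamma> a) (\<gamma> t) < r" if "t \<in> {a..b}" for t
      using that ab by (intro fine) auto
    have sub: "{a..b} \<subseteq> {0..1}" using ab by auto
    obtain j where j: "(?g has_integral j) {a..b}" "norm j \<le> \<epsilon> * dist (\<gamma> a) (\<gamma> b)"
    proof (rule path_piece_integral[of f "ball (\<gamma> a) r" \<epsilon> a b \<gamma> D "\<lambda>t. vector_derivative \<gamma> (at t within {0..1})"])
      show "f weakly_holomorphic_on ball (\<gamma> a) r"
        using nhd[of a] ab by (intro weakly_holomorphic_on_subset[OF f]) auto
      show "norm (f x) \<le> \<epsilon>" if "x \<in> ball (\<gamma> a) r" for x
        using nhd[of a] ab that by (intro bound) auto
      show "continuous_on {a..b} \<gamma>" by (rule continuous_on_subset[OF cont sub])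
      show "(\<gamma> has_vector_derivative vector_derivative \<gamma> (at t within {0..1})) (at t)"
        if "t \<in> {a<..<b} - D" for t using that ab by (intro der) auto
    qed (use ab near D(1) in auto)
    have "(?g has_integral (i + j)) {0..b}"
      using i(1) j(1) ab unfolding a_def[symmetric] by (intro has_integral_combine) auto
    moreover have "norm (i + j) \<le> real (Suc k) * (\<epsilon> * r)"
    proof -
      have "norm j \<le> \<epsilon> * r" using j(2) near[of b] ab \<epsilon> by (meson atLeastAtMost_iff less_imp_le mult_left_mono order_refl order_trans)
      then show ?thesis using norm_triangle_ineq[of i j] i(2) by (simp add: distrib_right)
    qed
    ultimately show ?case unfolding b_def by blast
  qed
  from this[of n] obtain i where "(?g has_integral i) {0..1}" "norm i \<le> real n * (\<epsilon> * r)" using n by auto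
  then show "?g integrable_on {0..1}" "norm (integral {0..1} ?g) \<le> real n * (\<epsilon> * r)"
    by (auto simp: integral_unique)
qed

lemma path_partition:
  assumes "valid_path \<gamma>" "r > 0"
  obtains n where "n > 0" "\<And>s t. s \<in> {0..1} \<Longrightarrow> t \<in> {0..1} \<Longrightarrow> \<bar>s - t\<bar> \<le> 1 / real n \<Longrightarrow> dist (\<gamma> s) (\<gamma> t) < r"
proof -
  have "uniformly_continuous_on {0..1} \<gamma>"
    using valid_path_imp_path[OF assms(1)] by (intro compact_uniformly_continuous) (auto simp: path_def)
  then obtain d where d: "d > 0" "\<And>s t. s \<in> {0..1} \<Longrightarrow> t \<in> {0..1} \<Longrightarrow> dist t s < d \<Longrightarrow> dist (\<gamma> t) (\<gamma> s) < r"
    using assms(2) unfolding uniformly_continuous_on_def by metis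
  obtain n where n: "n > 0" "inverse (real n) < d" using ex_inverse_of_nat_less[OF d(1)] by blast
  show ?thesis
  proof (rule that[OF n(1)])
    fix s t :: real assume "s \<in> {0..1}" "t \<in> {0..1}" "\<bar>s - t\<bar> \<le> 1 / real n"
    then show "dist (\<gamma> s) (\<gamma> t) < r" using n(2) by (intro d(2)) (auto simp: dist_real_def inverse_eq_divide)
  qed
qed

lemma blinfun_contour_integrable:
  fixes f :: "complex \<Rightarrow> 'a::chilbert_space \<Rightarrow>\<^sub>L 'a"
  assumes f: "f weakly_holomorphic_on U" and U: "open U"
    and \<gamma>: "valid_path \<gamma>" "path_image \<gamma> \<subseteq> U"
  shows "blinfun_contour_integrand \<gamma> f integrable_on {0..1}"
proof -
  have K: "compact (path_image \<gamma>)" using \<gamma>(1) by (simp add: compact_valid_path_image)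
  then obtain r where r: "r > 0" "(\<Union>x\<in>path_image \<gamma>. cball x r) \<subseteq> U"
    using compact_subset_open_imp_cball_epsilon_subset[OF K U \<gamma>(2)] by blast
  \<comment> \<open>A compact neighbourhood of the path inside \<open>U\<close>: \<open>f\<close> is
    bounded on it, as \<open>path_integral_bound\<close> requires.\<close>
  define V where "V = (\<Union>x\<in>path_image \<gamma>. cball x r)"
  have "compact V" unfolding V_def by (rule compact_minkowski_sum_cball[OF K])
  moreover have fV: "f weakly_holomorphic_on V"
    using f r(2) unfolding V_def by (rule weakly_holomorphic_on_subset)
  ultimately have "bounded (f ` V)"
    by (intro compact_imp_bounded compact_continuous_image) (auto simp: weakly_holomorphic_on_def)
  then obtain \<epsilon> where \<epsilon>: "\<And>x. x \<in> V \<Longrightarrow> norm (f x) \<le> \<epsilon>" unfolding bounded_iff by blast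
  obtain n where n: "n > 0" "\<And>s t. s \<in> {0..1} \<Longrightarrow> t \<in> {0..1} \<Longrightarrow> \<bar>s - t\<bar> \<le> 1 / real n \<Longrightarrow> dist (\<gamma> s) (\<gamma> t) < r"
    using path_partition[OF \<gamma>(1) r(1)] by blast
  show ?thesis
    by (rule path_integral_bound(1)[OF fV \<epsilon> \<gamma>(1) _ n]) (auto simp: V_def path_image_def)
qed

text \<open>Stated for a general functional because products of projections need
  \<open>\<phi> A = cinner (R (A u)) v\<close> with a resolvent \<open>R\<close> in front, besides
  plain matrix elements. The second assumption on \<open>\<phi>\<close> is complex homogeneity,
  which \<open>bounded_linear\<close> does not include.\<close>

lemma resolvent_integral_functional:
  fixes T :: "'a::chilbert_space graph"
  assumes T: "linear_operator T" and \<gamma>: "valid_path \<gamma>" "path_image \<gamma> \<subseteq> resolvent_set T"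
    and \<phi>: "bounded_linear \<phi>" "\<And>c A. \<phi> (scaleC_blinfun c A) = c * \<phi> A"
  shows "((\<lambda>\<xi>. \<phi> (resolvent T \<xi>)) has_contour_integral \<phi> (resolvent_integral \<gamma> T)) \<gamma>"
proof -
  have "blinfun_contour_integrand \<gamma> (resolvent T) integrable_on {0..1}"
    by (rule blinfun_contour_integrable[OF weakly_holomorphic_resolvent[OF T] open_resolvent_set[OF T] \<gamma>])
  then have "((\<phi> \<circ> blinfun_contour_integrand \<gamma> (resolvent T)) has_integral \<phi> (resolvent_integral \<gamma> T)) {0..1}"
    unfolding resolvent_integral_def by (intro has_integral_linear \<phi>(1) integrable_integral)
  then show ?thesis
    by (simp add: has_contour_integral_def o_def \<phi>(2) mult.commute)
qed

section \<open>Continuity of the spectral projection\<close>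

text \<open>Transports closeness at one point \<open>\<eta>\<close> to another point
  \<open>\<xi>\<close> by a factorization. The outer factors are formally
  \<open>R_S(\<xi>) (\<eta> - S)\<close> and \<open>(\<eta> - T) R_T(\<xi>)\<close>, so they turn
  the resolvents at \<open>\<eta>\<close> into resolvents at \<open>\<xi>\<close>.\<close>

lemma resolvent_compare:
  fixes S T :: "'a::chilbert_space graph"
  assumes S: "linear_operator S" "\<xi> \<in> resolvent_set S" "\<eta> \<in> resolvent_set S"
    and T: "linear_operator T" "\<xi> \<in> resolvent_set T" "\<eta> \<in> resolvent_set T"
    and a: "cmod (\<xi> - \<eta>) \<le> a" and p: "norm (resolvent S \<xi>) \<le> p" and q: "norm (resolvent T \<xi>) \<le> q"
  shows "norm (resolvent S \<xi> - resolvent T \<xi>) \<le>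
    (1 + a * p) * norm (resolvent S \<eta> - resolvent T \<eta>) * (1 + a * q)"
proof -
  let ?D = "resolvent S \<eta> - resolvent T \<eta>"
  let ?A = "id_blinfun - scaleC_blinfun (\<xi> - \<eta>) (resolvent S \<xi>)"
  let ?B = "id_blinfun - scaleC_blinfun (\<xi> - \<eta>) (resolvent T \<xi>)"
  have nonneg: "0 \<le> a" "0 \<le> p" "0 \<le> q"
    using a p q norm_ge_zero order_trans by blast+
  have factor: "norm (id_blinfun - scaleC_blinfun (\<xi> - \<eta>) R) \<le> 1 + a * k" if "norm R \<le> k" for R :: "'a \<Rightarrow>\<^sub>L 'a" and k
  proof (rule norm_blinfun_bound)
    have "0 \<le> k" using that norm_ge_zero[of R] by linarith
    then have "norm R * cmod (\<xi> - \<eta>) \<le> k * a" using that a by (intro mult_mono) auto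
    then have *: "cmod (\<xi> - \<eta>) * norm R \<le> a * k" by (simp add: mult.commute)
    then show "0 \<le> 1 + a * k" using norm_ge_zero[of R] norm_ge_zero[of "\<xi> - \<eta>"]
      by (smt (verit) mult_nonneg_nonneg)
    fix x
    have "norm (x - (\<xi> - \<eta>) *\<^sub>C R x) \<le> norm x + cmod (\<xi> - \<eta>) * (norm R * norm x)"
      by (intro order_trans[OF norm_triangle_ineq4] add_mono order_refl)
        (simp add: norm_scaleC mult_left_mono norm_blinfun)
    also have "\<dots> \<le> (1 + a * k) * norm x"
      using mult_right_mono[OF *, of "norm x"] by (simp add: algebra_simps)
    finally show "norm ((id_blinfun - scaleC_blinfun (\<xi> - \<eta>) R) x) \<le> (1 + a * k) * norm x"
      by (simp add: blinfun.diff_left)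
  qed
  have "resolvent S \<xi> - resolvent T \<xi> = ?A o\<^sub>L ?D o\<^sub>L ?B"
  proof (rule blinfun_eqI)
    fix x
    define y where "y = x - (\<xi> - \<eta>) *\<^sub>C resolvent T \<xi> x"
    have S_eq: "resolvent S \<eta> z - (\<xi> - \<eta>) *\<^sub>C resolvent S \<xi> (resolvent S \<eta> z) = resolvent S \<xi> z" for z
      using resolvent_identity[OF S(2,3,1), of z] by (simp add: scaleC.diff_left algebra_simps)
    have lin: "resolvent S \<xi> (c *\<^sub>C z) = c *\<^sub>C resolvent S \<xi> z" "resolvent T \<eta> (c *\<^sub>C z) = c *\<^sub>C resolvent T \<eta> z" for c z
      using complex_linear_resolvent[OF S(1,2)] complex_linear_resolvent[OF T(1,3)]
      by (auto simp: complex_linear_def)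
    have T_eq: "resolvent T \<eta> y = resolvent T \<xi> x"
      using resolvent_identity[OF T(3,2,1), of x]
      by (simp add: y_def blinfun.diff_right lin algebra_simps)
    have "(?A o\<^sub>L ?D o\<^sub>L ?B) x = (resolvent S \<eta> y - (\<xi> - \<eta>) *\<^sub>C resolvent S \<xi> (resolvent S \<eta> y))
        - (resolvent T \<xi> x - (\<xi> - \<eta>) *\<^sub>C resolvent S \<xi> (resolvent T \<xi> x))"
      unfolding T_eq[symmetric]
      by (simp add: y_def[symmetric] blinfun.diff_left blinfun.diff_right scaleC.diff_right algebra_simps)
    also have "\<dots> = resolvent S \<xi> x - resolvent T \<xi> x"
      unfolding S_eq by (simp add: y_def blinfun.diff_right lin)
    finally show "(resolvent S \<xi> - resolvent T \<xi>) x = (?A o\<^sub>L ?D o\<^sub>L ?B) x"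
      by (simp add: blinfun.diff_left)
  qed
  then have "norm (resolvent S \<xi> - resolvent T \<xi>) \<le> norm (?A o\<^sub>L ?D) * norm ?B"
    by (simp add: norm_blinfun_compose)
  also have "\<dots> \<le> norm ?A * norm ?D * norm ?B"
    by (intro mult_right_mono norm_blinfun_compose norm_ge_zero)
  also have "\<dots> \<le> (1 + a * p) * norm ?D * (1 + a * q)"
    using nonneg by (intro mult_mono factor p q) auto
  finally show ?thesis .
qed

text \<open>That \<open>K\<close> lies in the resolvent sets is assumed; what has to be found is a
  bound there uniform in \<open>s\<close>. The radius \<open>r\<close> is chosen before
  \<open>\<epsilon>\<close>, so that the number of pieces into which a contour is cut does not grow
  as \<open>\<epsilon>\<close> shrinks.\<close>

lemma resolvent_uniform_near_compact:
  fixes T :: "real \<Rightarrow> 'a::chilbert_space graph"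
  assumes rc: "resolvent_continuous_on I T" and s1: "s\<^sub>1 \<in> I"
    and K: "compact K" "K \<noteq> {}" and \<delta>: "\<delta> > 0"
    and KT: "\<And>s. s \<in> J \<Longrightarrow> dist s s\<^sub>1 < \<delta> \<Longrightarrow> K \<subseteq> resolvent_set (T s)"
    and J: "J \<subseteq> I" "s\<^sub>1 \<in> J"
  obtains r where "r > 0"
    "\<And>\<epsilon>. \<epsilon> > 0 \<Longrightarrow> \<exists>d>0. \<forall>s\<in>J. dist s s\<^sub>1 < d \<longrightarrow> (\<forall>x\<in>K. \<forall>\<xi>\<in>ball x r.
      \<xi> \<in> resolvent_set (T s) \<and> \<xi> \<in> resolvent_set (T s\<^sub>1) \<and>
      norm (resolvent (T s) \<xi> - resolvent (T s\<^sub>1) \<xi>) \<le> \<epsilon>)"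
proof -
  have lin: "linear_operator (T s)" if "s \<in> J" for s
    using rc that J unfolding resolvent_continuous_on_def by blast
  obtain \<eta> \<delta>\<^sub>0 where \<delta>0: "\<delta>\<^sub>0 > 0" and \<eta>: "\<And>s. s \<in> I \<inter> ball s\<^sub>1 \<delta>\<^sub>0 \<Longrightarrow> \<eta> \<in> resolvent_set (T s)"
    and cont: "continuous_on (I \<inter> ball s\<^sub>1 \<delta>\<^sub>0) (\<lambda>s. resolvent (T s) \<eta>)"
    using rc s1 unfolding resolvent_continuous_on_def by meson
  define D where "D s = norm (resolvent (T s) \<eta> - resolvent (T s\<^sub>1) \<eta>)" for s
  have D: "\<exists>d>0. d \<le> \<delta>\<^sub>0 \<and> (\<forall>s\<in>J. dist s s\<^sub>1 < d \<longrightarrow> D s < e)" if e: "e > 0" for e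
  proof -
    have "s\<^sub>1 \<in> I \<inter> ball s\<^sub>1 \<delta>\<^sub>0" using s1 \<delta>0 by simp
    then obtain d where "d > 0" "\<forall>s\<in>I \<inter> ball s\<^sub>1 \<delta>\<^sub>0. dist s s\<^sub>1 < d \<longrightarrow>
        dist (resolvent (T s) \<eta>) (resolvent (T s\<^sub>1) \<eta>) < e"
      using cont e unfolding continuous_on_iff by blast
    then show ?thesis using \<delta>0 J
      by (intro exI[of _ "min d \<delta>\<^sub>0"]) (auto simp: D_def dist_norm dist_commute)
  qed
  have K1: "K \<subseteq> resolvent_set (T s\<^sub>1)" using KT[OF J(2)] \<delta> by simp
  have "bounded (resolvent (T s\<^sub>1) ` K)"
    using continuous_on_subset[OF continuous_on_resolvent[OF lin[OF J(2)]] K1] K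
    by (intro compact_imp_bounded compact_continuous_image)
  then obtain M where M: "\<And>x. x \<in> K \<Longrightarrow> norm (resolvent (T s\<^sub>1) x) \<le> M" unfolding bounded_iff by blast
  have M0: "M \<ge> 0" using K(2) M norm_ge_zero order_trans by blast
  have "bounded ((\<lambda>x. x - \<eta>) ` K)"
    using K by (intro compact_imp_bounded compact_continuous_image continuous_intros)
  then obtain a where a: "\<And>x. x \<in> K \<Longrightarrow> cmod (x - \<eta>) \<le> a" unfolding bounded_iff by blast
  have a0: "a \<ge> 0" using K(2) a norm_ge_zero order_trans by blast
  \<comment> \<open>One constant above \<open>1\<close>, \<open>a\<close> and
    \<open>1 + a * M\<close>, the quantities that appear in the outer factors of
    \<open>resolvent_compare\<close>.\<close>
  define C where "C = (1 + a) * (1 + M)"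
  have C: "C \<ge> 1" "a \<le> C" "1 + a * M \<le> C"
    using a0 M0 mult_nonneg_nonneg[OF a0 M0] by (auto simp: C_def algebra_simps)
  have "1 / (2 * C\<^sup>2) > 0" using C(1) by simp
  from D[OF this] obtain d\<^sub>1 where d1: "d\<^sub>1 > 0" "d\<^sub>1 \<le> \<delta>\<^sub>0"
    "\<And>s. s \<in> J \<Longrightarrow> dist s s\<^sub>1 < d\<^sub>1 \<Longrightarrow> D s < 1 / (2 * C\<^sup>2)"
    by blast
  have bound: "norm (resolvent (T s) x) \<le> M + 1"
    if s: "s \<in> J" "dist s s\<^sub>1 < d\<^sub>1" "dist s s\<^sub>1 < \<delta>" and x: "x \<in> K" for s x
  proof -
    define q where "q = norm (resolvent (T s) x - resolvent (T s\<^sub>1) x)"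
    have q0: "q \<ge> 0" by (simp add: q_def)
    have D0: "D s \<ge> 0" by (simp add: D_def)
    have le: "norm (resolvent (T s) x) \<le> M + q"
      unfolding q_def using norm_triangle_sub[of "resolvent (T s) x" "resolvent (T s\<^sub>1) x"] M[OF x] by linarith
    \<comment> \<open>The only bound available for \<open>resolvent (T s) x\<close> is
      \<open>M + q\<close>, so the estimate contains \<open>q\<close> on both sides. The choice
      \<open>D s < 1 / (2 * C\<^sup>2)\<close> closes it as
      \<open>q \<le> (1 + q) / 2\<close>.\<close>
    have "q \<le> (1 + a * (M + q)) * D s * (1 + a * M)"
      unfolding q_def D_def
    proof (rule resolvent_compare[OF lin[OF s(1)] _ _ lin[OF J(2)]])
      show "x \<in> resolvent_set (T s)" using KT s x by blast
      show "x \<in> resolvent_set (T s\<^sub>1)" using K1 x by blast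
      show "\<eta> \<in> resolvent_set (T s)" using s J d1 by (intro \<eta>) (auto simp: dist_commute)
      show "\<eta> \<in> resolvent_set (T s\<^sub>1)" using J \<delta>0 by (intro \<eta>) auto
    qed (use a M x le in \<open>auto simp: q_def\<close>)
    also have "\<dots> \<le> (C + C * q) * D s * C"
    proof (intro mult_mono order_refl)
      show "1 + a * (M + q) \<le> C + C * q"
        using C mult_right_mono[OF C(2) q0] by (simp add: algebra_simps)
    qed (use C D0 a0 M0 q0 in auto)
    also have "\<dots> = (1 + q) * (C\<^sup>2 * D s)" by (simp add: power2_eq_square algebra_simps)
    also have "\<dots> \<le> (1 + q) * (1 / 2)"
    proof (rule mult_left_mono)
      show "C\<^sup>2 * D s \<le> 1 / 2" using d1(3)[OF s(1,2)] C by (simp add: field_simps)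
    qed (use q0 in auto)
    finally have "q \<le> 1" by simp
    then show ?thesis using le by linarith
  qed
  \<comment> \<open>The radius on which \<open>resolvent_set_ball\<close> extends the bound
    \<open>M + 1\<close> from a point of \<open>K\<close> to its neighbours, at the price of a
    factor 2.\<close>
  define r where "r = 1 / (2 * (M + 1))"
  define N where "N = 2 * (M + 1)"
  have r: "r > 0" using M0 by (simp add: r_def)
  have N: "N > 0" using M0 by (simp add: N_def)
  have ball: "\<xi> \<in> resolvent_set (T s) \<and> norm (resolvent (T s) \<xi>) \<le> N"
    if s: "s \<in> J" "dist s s\<^sub>1 < d\<^sub>1" "dist s s\<^sub>1 < \<delta>" and x: "x \<in> K" "\<xi> \<in> ball x r" for s x \<xi>
  proof -
    have "x \<in> resolvent_set (T s)" using KT s x by blast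
    moreover have "cmod (\<xi> - x) * (M + 1) \<le> 1 / 2"
      using x(2) M0 by (simp add: r_def dist_norm norm_minus_commute field_simps)
    ultimately show ?thesis
      unfolding N_def using resolvent_set_ball[OF lin[OF s(1)] _ bound[OF s x(1)]] by blast
  qed
  show ?thesis
  proof (rule that[OF r])
    fix \<epsilon> :: real assume \<epsilon>: "\<epsilon> > 0"
    \<comment> \<open>Bounds both outer factors of \<open>resolvent_compare\<close>, since
      \<open>cmod (\<xi> - \<eta>) \<le> a + r\<close> and both resolvents are at most
      \<open>N\<close>.\<close>
    define B where "B = 1 + (a + r) * N"
    have B: "B > 0" using a0 r N by (simp add: B_def add_pos_nonneg)
    have "\<epsilon> / B\<^sup>2 > 0" using \<epsilon> B by simp
    from D[OF this] obtain d\<^sub>2 where d2: "d\<^sub>2 > 0" "\<And>s. s \<in> J \<Longrightarrow> dist s s\<^sub>1 < d\<^sub>2 \<Longrightarrow> D s < \<epsilon> / B\<^sup>2"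
      by blast
    show "\<exists>d>0. \<forall>s\<in>J. dist s s\<^sub>1 < d \<longrightarrow> (\<forall>x\<in>K. \<forall>\<xi>\<in>ball x r.
      \<xi> \<in> resolvent_set (T s) \<and> \<xi> \<in> resolvent_set (T s\<^sub>1) \<and>
      norm (resolvent (T s) \<xi> - resolvent (T s\<^sub>1) \<xi>) \<le> \<epsilon>)"
    proof (intro exI[of _ "min (min d\<^sub>1 \<delta>) d\<^sub>2"] conjI ballI impI)
      fix s x \<xi> assume s: "s \<in> J" "dist s s\<^sub>1 < min (min d\<^sub>1 \<delta>) d\<^sub>2" and x: "x \<in> K" "\<xi> \<in> ball x r"
      have b: "\<xi> \<in> resolvent_set (T s)" "norm (resolvent (T s) \<xi>) \<le> N"
        using ball[OF s(1) _ _ x] s(2) by auto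
      have b1: "\<xi> \<in> resolvent_set (T s\<^sub>1)" "norm (resolvent (T s\<^sub>1) \<xi>) \<le> N"
        using ball[OF J(2) _ _ x] d1(1) \<delta> by auto
      show "\<xi> \<in> resolvent_set (T s)" "\<xi> \<in> resolvent_set (T s\<^sub>1)" by fact+
      have "norm (resolvent (T s) \<xi> - resolvent (T s\<^sub>1) \<xi>) \<le> (1 + (a + r) * N) * D s * (1 + (a + r) * N)"
        unfolding D_def
      proof (rule resolvent_compare[OF lin[OF s(1)] b(1) _ lin[OF J(2)] b1(1)])
        show "\<eta> \<in> resolvent_set (T s)" using s J d1 by (intro \<eta>) (auto simp: dist_commute)
        show "\<eta> \<in> resolvent_set (T s\<^sub>1)" using J \<delta>0 by (intro \<eta>) auto
        have "cmod (\<xi> - \<eta>) \<le> cmod (x - \<eta>) + cmod (\<xi> - x)"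
          using norm_triangle_ineq[of "x - \<eta>" "\<xi> - x"] by simp
        then show "cmod (\<xi> - \<eta>) \<le> a + r" using a[OF x(1)] x(2) by (simp add: dist_norm norm_minus_commute)
      qed (use b b1 in auto)
      also have "\<dots> = B\<^sup>2 * D s" by (simp add: B_def power2_eq_square algebra_simps)
      also have "\<dots> \<le> \<epsilon>" using d2(2)[OF s(1)] s(2) B by (simp add: field_simps)
      finally show "norm (resolvent (T s) \<xi> - resolvent (T s\<^sub>1) \<xi>) \<le> \<epsilon>" .
    qed (use d1 d2 \<delta> in auto)
  qed
qed

lemma resolvent_integral_tendsto:
  fixes T :: "real \<Rightarrow> 'a::chilbert_space graph"
  assumes rc: "resolvent_continuous_on I T" and J: "J \<subseteq> I" "s\<^sub>1 \<in> J" and \<delta>: "\<delta> > 0"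
    and \<gamma>: "valid_path \<gamma>" "\<And>s. s \<in> J \<Longrightarrow> dist s s\<^sub>1 < \<delta> \<Longrightarrow> path_image \<gamma> \<subseteq> resolvent_set (T s)"
  shows "((\<lambda>s. resolvent_integral \<gamma> (T s)) \<longlongrightarrow> resolvent_integral \<gamma> (T s\<^sub>1)) (at s\<^sub>1 within J)"
proof -
  have lin: "linear_operator (T s)" if "s \<in> J" for s
    using rc that J unfolding resolvent_continuous_on_def by blast
  obtain r where r: "r > 0"
    "\<And>\<epsilon>. \<epsilon> > 0 \<Longrightarrow> \<exists>d>0. \<forall>s\<in>J. dist s s\<^sub>1 < d \<longrightarrow> (\<forall>x\<in>path_image \<gamma>. \<forall>\<xi>\<in>ball x r.
      \<xi> \<in> resolvent_set (T s) \<and> \<xi> \<in> resolvent_set (T s\<^sub>1) \<and>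
      norm (resolvent (T s) \<xi> - resolvent (T s\<^sub>1) \<xi>) \<le> \<epsilon>)"
  proof (rule resolvent_uniform_near_compact[OF rc _ _ _ \<delta> \<gamma>(2) J])
    show "compact (path_image \<gamma>)" using \<gamma>(1) by (rule compact_valid_path_image)
  qed (use J in \<open>auto simp: subset_iff\<close>)
  obtain n where n: "n > 0" "\<And>s t. s \<in> {0..1} \<Longrightarrow> t \<in> {0..1} \<Longrightarrow> \<bar>s - t\<bar> \<le> 1 / real n \<Longrightarrow> dist (\<gamma> s) (\<gamma> t) < r"
    using path_partition[OF \<gamma>(1) r(1)] by blast
  show ?thesis
    unfolding tendsto_iff eventually_at
  proof (intro allI impI)
    fix e :: real assume e: "e > 0"
    \<comment> \<open>Makes the bound \<open>real n * (\<epsilon> * r)\<close> equal to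
      \<open>e / 2\<close>; this is possible because \<open>n\<close> and \<open>r\<close> are
      already fixed.\<close>
    define \<epsilon> where "\<epsilon> = e / (2 * real n * r)"
    have \<epsilon>: "\<epsilon> > 0" using e n r by (simp add: \<epsilon>_def)
    obtain d where d: "d > 0" "\<And>s x \<xi>. s \<in> J \<Longrightarrow> dist s s\<^sub>1 < d \<Longrightarrow> x \<in> path_image \<gamma> \<Longrightarrow> \<xi> \<in> ball x r \<Longrightarrow>
      \<xi> \<in> resolvent_set (T s) \<and> \<xi> \<in> resolvent_set (T s\<^sub>1) \<and>
      norm (resolvent (T s) \<xi> - resolvent (T s\<^sub>1) \<xi>) \<le> \<epsilon>"
      using r(2)[OF \<epsilon>] by blast
    define U where "U = (\<Union>x\<in>path_image \<gamma>. ball x r)"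
    show "\<exists>d>0. \<forall>s\<in>J. s \<noteq> s\<^sub>1 \<and> dist s s\<^sub>1 < d \<longrightarrow>
        dist (resolvent_integral \<gamma> (T s)) (resolvent_integral \<gamma> (T s\<^sub>1)) < e"
    proof (intro exI[of _ "min d \<delta>"] conjI ballI impI)
      fix s assume s: "s \<in> J" "s \<noteq> s\<^sub>1 \<and> dist s s\<^sub>1 < min d \<delta>"
      let ?f = "\<lambda>\<xi>. resolvent (T s) \<xi> - resolvent (T s\<^sub>1) \<xi>"
      have U: "U \<subseteq> resolvent_set (T s)" "U \<subseteq> resolvent_set (T s\<^sub>1)" "\<And>\<xi>. \<xi> \<in> U \<Longrightarrow> norm (?f \<xi>) \<le> \<epsilon>"
        using d(2)[OF s(1)] s(2) unfolding U_def by auto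
      have f: "?f weakly_holomorphic_on U"
        using lin[OF s(1)] lin[OF J(2)] U
        by (blast intro: weakly_holomorphic_on_diff weakly_holomorphic_on_subset weakly_holomorphic_resolvent)
      have int: "blinfun_contour_integrand \<gamma> (resolvent (T t)) integrable_on {0..1}"
        if "t \<in> J" "dist t s\<^sub>1 < \<delta>" for t
        using lin[OF that(1)] \<gamma>(1) \<gamma>(2)[OF that]
        by (intro blinfun_contour_integrable[of _ "resolvent_set (T t)"] weakly_holomorphic_resolvent open_resolvent_set)
      have "norm (integral {0..1} (blinfun_contour_integrand \<gamma> ?f)) \<le> real n * (\<epsilon> * r)"
        by (rule path_integral_bound(2)[OF f U(3) \<gamma>(1) _ n]) (auto simp: U_def path_image_def)
      also have "integral {0..1} (blinfun_contour_integrand \<gamma> ?f) =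
          resolvent_integral \<gamma> (T s) - resolvent_integral \<gamma> (T s\<^sub>1)"
        unfolding resolvent_integral_def scaleCb.diff_right using s J \<delta>
        by (intro Henstock_Kurzweil_Integration.integral_diff int) auto
      also have "real n * (\<epsilon> * r) = e / 2" using n r by (simp add: \<epsilon>_def)
      finally show "dist (resolvent_integral \<gamma> (T s)) (resolvent_integral \<gamma> (T s\<^sub>1)) < e"
        using e by (simp add: dist_norm)
    qed (use d \<delta> in auto)
  qed
qed

lemma spectral_projection_tendsto:
  fixes T :: "real \<Rightarrow> 'a::chilbert_space graph"
  assumes rc: "resolvent_continuous_on I T" and J: "J \<subseteq> I" "s\<^sub>1 \<in> J" and \<delta>: "\<delta> > 0"
    and \<Gamma>: "\<And>\<gamma>. \<gamma> \<in> set \<Gamma> \<Longrightarrow> valid_path \<gamma>"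
      "\<And>s \<gamma>. s \<in> J \<Longrightarrow> dist s s\<^sub>1 < \<delta> \<Longrightarrow> \<gamma> \<in> set \<Gamma> \<Longrightarrow> path_image \<gamma> \<subseteq> resolvent_set (T s)"
  shows "((\<lambda>s. spectral_projection \<Gamma> (T s)) \<longlongrightarrow> spectral_projection \<Gamma> (T s\<^sub>1)) (at s\<^sub>1 within J)"
proof -
  have "((\<lambda>s. \<Sum>\<gamma>\<leftarrow>\<Gamma>. resolvent_integral \<gamma> (T s)) \<longlongrightarrow> (\<Sum>\<gamma>\<leftarrow>\<Gamma>. resolvent_integral \<gamma> (T s\<^sub>1))) (at s\<^sub>1 within J)"
    using \<Gamma>
  proof (induction \<Gamma>)
    case (Cons \<gamma> \<Gamma>)
    then show ?case
      by (auto intro!: tendsto_add resolvent_integral_tendsto[OF rc J \<delta>])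
  qed simp
  then show ?thesis
    unfolding spectral_projection_def by (intro scaleCb.tendsto tendsto_const)
qed

lemma continuous_on_eigenvalue_system:
  fixes T :: "real \<Rightarrow> 'a::chilbert_space graph"
  assumes rc: "resolvent_continuous_on I T" and J: "J \<subseteq> I" and sys: "eigenvalue_system J T S P"
  shows "continuous_on J P"
  unfolding continuous_on_def
proof
  fix s\<^sub>1 assume s1: "s\<^sub>1 \<in> J"
  then obtain \<Gamma> \<delta> where \<Gamma>: "encloses_exactly \<Gamma> (S s\<^sub>1) (op_spectrum (T s\<^sub>1))" and \<delta>: "\<delta> > 0"
    and loc: "\<And>s. s \<in> J \<inter> ball s\<^sub>1 \<delta> \<Longrightarrow> (\<forall>\<gamma>\<in>set \<Gamma>. path_image \<gamma> \<subseteq> resolvent_set (T s)) \<and>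
      P s = spectral_projection \<Gamma> (T s)"
    using sys unfolding eigenvalue_system_def by meson
  have "((\<lambda>s. spectral_projection \<Gamma> (T s)) \<longlongrightarrow> spectral_projection \<Gamma> (T s\<^sub>1)) (at s\<^sub>1 within J)"
  proof (rule spectral_projection_tendsto[OF rc J s1 \<delta>])
    show "path_image \<gamma> \<subseteq> resolvent_set (T s)" if "s \<in> J" "dist s s\<^sub>1 < \<delta>" "\<gamma> \<in> set \<Gamma>" for s \<gamma>
      using loc[of s] that by (auto simp: dist_commute)
  qed (use \<Gamma> in \<open>auto simp: encloses_exactly_def\<close>)
  moreover have "spectral_projection \<Gamma> (T s\<^sub>1) = P s\<^sub>1" using loc[of s\<^sub>1] s1 \<delta> by simp
  moreover have "\<forall>\<^sub>F s in at s\<^sub>1 within J. spectral_projection \<Gamma> (T s) = P s"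
    unfolding eventually_at using \<delta> loc by (intro exI[of _ \<delta>]) (auto simp: dist_commute)
  ultimately show "(P \<longlongrightarrow> P s\<^sub>1) (at s\<^sub>1 within J)"
    using Lim_transform_eventually by fastforce
qed

section \<open>Riesz projections\<close>

text \<open>The component \<open>D\<close> of \<open>z\<close> misses the path and is not the whole
  plane. A boundary point \<open>w\<close> of \<open>D\<close> cannot lie in \<open>U\<close>, so
  the winding number vanishes at \<open>w\<close>; it is constant on the connected set
  \<open>insert w D\<close>, which also misses the path.\<close>

lemma winding_number_zero_other_component:
  assumes U: "open U" and \<gamma>: "path \<gamma>" "pathfinish \<gamma> = pathstart \<gamma>" "path_image \<gamma> \<subseteq> U"
    and zero: "\<And>z. z \<notin> U \<Longrightarrow> winding_number \<gamma> z = 0"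
    and z: "z \<notin> connected_component_set U (pathstart \<gamma>)"
  shows "winding_number \<gamma> z = 0"
proof (cases "z \<in> U")
  case True
  define C where "C = connected_component_set U (pathstart \<gamma>)"
  define D where "D = connected_component_set U z"
  have D: "open D" "connected D" "z \<in> D" "D \<subseteq> U"
    using True U by (auto simp: D_def open_connected_component connected_component_subset
      connected_component_refl)
  have \<gamma>C: "path_image \<gamma> \<subseteq> C"
    unfolding C_def using \<gamma> by (intro connected_component_maximal connected_path_image) auto
  have "C \<inter> D = {}"
    using z connected_component_eq[of z U "pathstart \<gamma>"] connected_component_nonoverlap[of U "pathstart \<gamma>" z]
    unfolding C_def D_def using True connected_component_refl[OF True] by fastforce
  then have D\<gamma>: "D \<inter> path_image \<gamma> = {}" using \<gamma>C by blast
  then have "D \<noteq> UNIV" using pathstart_in_path_image[of \<gamma>] by blast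
  then have "frontier D \<noteq> {}" using D(3) frontier_eq_empty by blast
  then obtain w where w: "w \<in> closure D" "w \<notin> D"
    using D(1) by (auto simp: frontier_def interior_open)
  have "w \<notin> U"
  proof
    assume "w \<in> U"
    then have "open (connected_component_set U w)" "w \<in> connected_component_set U w"
      using U by (auto simp: open_connected_component connected_component_refl)
    then have "connected_component_set U w \<inter> D \<noteq> {}"
      using w(1) by (meson disjoint_iff open_Int_closure_eq_empty)
    then have "connected_component_set U w = D"
      unfolding D_def by (metis connected_component_nonoverlap)
    then show False using \<open>w \<in> connected_component_set U w\<close> w(2) by blast
  qed
  then have w0: "winding_number \<gamma> w = 0" "w \<notin> path_image \<gamma>" using zero \<gamma>(3) by auto
  have "connected (insert w D)"
    using w(1) closure_subset[of D] by (intro connected_intermediate_closure[OF D(2)]) auto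
  then have "winding_number \<gamma> z = winding_number \<gamma> w"
    using D\<gamma> w0 D(3) \<gamma> by (intro winding_number_eq[of \<gamma> z "insert w D" w]) auto
  then show ?thesis using w0 by simp
qed (use zero in auto)

text \<open>The residue theorem of the library needs a connected domain.\<close>

lemma Residue_theorem_open:
  assumes \<rho>: "open (\<rho> \<union> S)" "finite S" "\<rho> \<inter> S = {}" and f: "f holomorphic_on \<rho>"
    and \<gamma>: "valid_path \<gamma>" "pathfinish \<gamma> = pathstart \<gamma>" "path_image \<gamma> \<subseteq> \<rho>"
    and zero: "\<And>z. z \<notin> \<rho> \<union> S \<Longrightarrow> winding_number \<gamma> z = 0"
  shows "contour_integral \<gamma> f = complex_of_real (2 * pi) * \<i> * (\<Sum>p\<in>S. winding_number \<gamma> p * residue f p)"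
proof -
  define C where "C = connected_component_set (\<rho> \<union> S) (pathstart \<gamma>)"
  have \<gamma>': "path \<gamma>" "path_image \<gamma> \<subseteq> \<rho> \<union> S" using \<gamma> by (auto simp: valid_path_imp_path)
  have C: "open C" "connected C" "C \<subseteq> \<rho> \<union> S"
    using \<rho>(1) by (auto simp: C_def open_connected_component connected_component_subset)
  have "path_image \<gamma> \<subseteq> C"
    unfolding C_def using \<gamma>' by (intro connected_component_maximal connected_path_image) auto
  moreover have "f holomorphic_on C - S" using C(3) by (intro holomorphic_on_subset[OF f]) auto
  ultimately show ?thesis
    using C \<rho> \<gamma> winding_number_zero_other_component[OF \<rho>(1) \<gamma>'(1) \<gamma>(2) \<gamma>'(2) zero, folded C_def]
    by (intro Residue_theorem[of C]) auto
qed

section \<open>Matrix elements of spectral projections as residues\<close>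

lemma holomorphic_on_resolvent_functional:
  fixes T :: "'a::chilbert_space graph"
  assumes "linear_operator T"
  shows "(\<lambda>\<xi>. cinner (resolvent T \<xi> u) v) holomorphic_on resolvent_set T"
  using weakly_holomorphic_resolvent[OF assms] by (simp add: weakly_holomorphic_on_def)

lemma spectral_projection_functional:
  fixes T :: "'a::chilbert_space graph"
  assumes T: "linear_operator T" and \<Gamma>: "\<And>\<gamma>. \<gamma> \<in> set \<Gamma> \<Longrightarrow> valid_path \<gamma> \<and> path_image \<gamma> \<subseteq> resolvent_set T"
    and \<phi>: "bounded_linear \<phi>" "\<And>c A. \<phi> (scaleC_blinfun c A) = c * \<phi> A"
  shows "\<phi> (spectral_projection \<Gamma> T) =
    1 / (2 * complex_of_real pi * \<i>) * (\<Sum>\<gamma>\<leftarrow>\<Gamma>. contour_integral \<gamma> (\<lambda>\<xi>. \<phi> (resolvent T \<xi>)))"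
proof -
  interpret bounded_linear \<phi> by (rule \<phi>(1))
  have "\<phi> (\<Sum>\<gamma>\<leftarrow>\<Gamma>. resolvent_integral \<gamma> T) = (\<Sum>\<gamma>\<leftarrow>\<Gamma>. contour_integral \<gamma> (\<lambda>\<xi>. \<phi> (resolvent T \<xi>)))"
    using \<Gamma>
  proof (induction \<Gamma>)
    case (Cons \<gamma> \<Gamma>)
    then have "\<phi> (resolvent_integral \<gamma> T) = contour_integral \<gamma> (\<lambda>\<xi>. \<phi> (resolvent T \<xi>))"
      by (intro contour_integral_unique[symmetric] resolvent_integral_functional[OF T _ _ \<phi>]) auto
    then show ?case using Cons by (simp add: add)
  qed (simp add: zero)
  then show ?thesis unfolding spectral_projection_def by (simp add: \<phi>(2))
qed

text \<open>The isolation clause of \<open>discrete_eigenvalues\<close> with the radius made a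
  parameter, so that one radius can serve a whole finite set.\<close>

definition isolated_radius :: "'a::complex_inner graph \<Rightarrow> complex \<Rightarrow> real \<Rightarrow> bool"
  where "isolated_radius T z r \<longleftrightarrow> r > 0 \<and> op_spectrum T \<inter> cball z r = {z}"

lemma isolated_radius_mono:
  assumes "isolated_radius T z r" "0 < r'" "r' \<le> r"
  shows "isolated_radius T z r'"
proof -
  have "op_spectrum T \<inter> cball z r = {z}" using assms(1) by (simp add: isolated_radius_def)
  moreover have "cball z r' \<subseteq> cball z r" "z \<in> cball z r'" using assms(2,3) by auto
  ultimately have "op_spectrum T \<inter> cball z r' = {z}" by blast
  then show ?thesis using assms(2) by (simp add: isolated_radius_def)
qed

lemma isolated_radius_resolvent:
  assumes "isolated_radius T z r" "dist z \<xi> \<le> r" "\<xi> \<noteq> z"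
  shows "\<xi> \<in> resolvent_set T"
proof -
  have "op_spectrum T \<inter> cball z r = {z}" using assms(1) by (simp add: isolated_radius_def)
  moreover have "\<xi> \<in> cball z r" using assms(2) by simp
  ultimately show ?thesis using assms(3) unfolding op_spectrum_def by blast
qed

lemma isolated_radius_spectrum:
  "isolated_radius T z r \<Longrightarrow> z \<notin> resolvent_set T"
  unfolding isolated_radius_def op_spectrum_def by auto

lemma isolated_radius_path:
  assumes "isolated_radius T z r"
  shows "path_image (circlepath z r) \<subseteq> resolvent_set T"
  using assms by (auto intro!: isolated_radius_resolvent[OF assms] simp: isolated_radius_def)

lemma open_insert_isolated:
  fixes T :: "'a::chilbert_space graph"
  assumes T: "linear_operator T" and S: "\<And>z. z \<in> S \<Longrightarrow> isolated_radius T z r"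
  shows "open (resolvent_set T \<union> S)"
proof -
  have "resolvent_set T \<union> S = resolvent_set T \<union> (\<Union>z\<in>S. ball z r)"
    using S by (auto simp: isolated_radius_def intro: isolated_radius_resolvent[OF S])
  then show ?thesis using open_resolvent_set[OF T] by (metis open_Un open_UN open_ball)
qed

text \<open>The residue does not mention \<open>r\<close>; independence of the radius and, with the
  residue theorem, of the contour follows from this.\<close>

lemma circle_projection_residue:
  fixes T :: "'a::chilbert_space graph"
  assumes T: "linear_operator T" and r: "isolated_radius T z r"
  shows "cinner (spectral_projection [circlepath z r] T u) v = residue (\<lambda>\<xi>. cinner (resolvent T \<xi> u) v) z"
proof -
  have "((\<lambda>\<xi>. cinner (resolvent T \<xi> u) v) has_contour_integral
      complex_of_real (2 * pi) * \<i> * residue (\<lambda>\<xi>. cinner (resolvent T \<xi> u) v) z) (circlepath z r)"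
  proof (rule base_residue[where s = "resolvent_set T \<union> {z}"])
    show "open (resolvent_set T \<union> {z})" using open_insert_isolated[OF T, of "{z}" r] r by simp
    show "(\<lambda>\<xi>. cinner (resolvent T \<xi> u) v) holomorphic_on resolvent_set T \<union> {z} - {z}"
      by (rule holomorphic_on_subset[OF holomorphic_on_resolvent_functional[OF T]]) auto
    show "cball z r \<subseteq> resolvent_set T \<union> {z}" using isolated_radius_resolvent[OF r] by fastforce
  qed (use r in \<open>auto simp: isolated_radius_def\<close>)
  then show ?thesis
    using spectral_projection_functional[OF T, of "[circlepath z r]" "\<lambda>A. cinner (A u) v"]
      isolated_radius_path[OF r]
    by (simp add: bounded_linear_cinner_apply cinner_scaleC_left contour_integral_unique)
qed

lemma circle_projection_radius:
  fixes T :: "'a::chilbert_space graph"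
  assumes "linear_operator T" "isolated_radius T z r" "isolated_radius T z r'"
  shows "spectral_projection [circlepath z r] T = spectral_projection [circlepath z r'] T"
  by (rule blinfun_cinner_ext) (simp add: circle_projection_residue assms)

lemma sum_list_sum_swap:
  "(\<Sum>x\<leftarrow>xs. \<Sum>y\<in>S. f x y) = (\<Sum>y\<in>S. \<Sum>x\<leftarrow>xs. (f x y :: 'b::comm_monoid_add))"
  by (induction xs) (simp_all add: sum.distrib)

text \<open>In the residue theorem each point of \<open>S\<close> is weighted by its winding number,
  and over the whole list of curves these weights add up to 1. This trades an arbitrary contour for
  circles, which can be nested for products and reflected for symmetry.\<close>

lemma spectral_projection_decompose:
  fixes T :: "'a::chilbert_space graph"
  assumes T: "linear_operator T" and S: "finite S" "\<And>z. z \<in> S \<Longrightarrow> isolated_radius T z r"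
    and \<Gamma>: "encloses_exactly \<Gamma> S (op_spectrum T)"
  shows "spectral_projection \<Gamma> T = (\<Sum>z\<in>S. spectral_projection [circlepath z r] T)"
proof (rule blinfun_cinner_ext)
  fix u v
  let ?f = "\<lambda>\<xi>. cinner (resolvent T \<xi> u) v"
  have path: "valid_path \<gamma>" "pathfinish \<gamma> = pathstart \<gamma>" "path_image \<gamma> \<subseteq> resolvent_set T"
    if "\<gamma> \<in> set \<Gamma>" for \<gamma>
    using \<Gamma> that unfolding encloses_exactly_def op_spectrum_def by auto
  have ci: "contour_integral \<gamma> ?f = complex_of_real (2 * pi) * \<i> * (\<Sum>z\<in>S. winding_number \<gamma> z * residue ?f z)"
    if \<gamma>: "\<gamma> \<in> set \<Gamma>" for \<gamma>
  proof (rule Residue_theorem_open[OF open_insert_isolated[OF T S(2)] S(1) _ _ path[OF \<gamma>]])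
    show "resolvent_set T \<inter> S = {}" using S(2) isolated_radius_spectrum by blast
    show "?f holomorphic_on resolvent_set T" by (rule holomorphic_on_resolvent_functional[OF T])
    show "winding_number \<gamma> z = 0" if "z \<notin> resolvent_set T \<union> S" for z
      using \<Gamma> \<gamma> that unfolding encloses_exactly_def op_spectrum_def by auto
  qed
  have "cinner (spectral_projection \<Gamma> T u) v = 1 / (2 * complex_of_real pi * \<i>) * (\<Sum>\<gamma>\<leftarrow>\<Gamma>. contour_integral \<gamma> ?f)"
    by (rule spectral_projection_functional[OF T]) (auto simp: path bounded_linear_cinner_apply cinner_scaleC_left)
  also have "(\<Sum>\<gamma>\<leftarrow>\<Gamma>. contour_integral \<gamma> ?f) =
      (\<Sum>\<gamma>\<leftarrow>\<Gamma>. complex_of_real (2 * pi) * \<i> * (\<Sum>z\<in>S. winding_number \<gamma> z * residue ?f z))"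
    using ci by (intro arg_cong[of _ _ sum_list] map_cong) auto
  also have "\<dots> = 2 * complex_of_real pi * \<i> * (\<Sum>z\<in>S. (\<Sum>\<gamma>\<leftarrow>\<Gamma>. winding_number \<gamma> z) * residue ?f z)"
    by (simp add: sum_list_const_mult sum_list_sum_swap sum_list_mult_const)
  also have "(\<Sum>z\<in>S. (\<Sum>\<gamma>\<leftarrow>\<Gamma>. winding_number \<gamma> z) * residue ?f z) = (\<Sum>z\<in>S. residue ?f z)"
    using \<Gamma> unfolding encloses_exactly_def by (intro sum.cong) auto
  also have "1 / (2 * complex_of_real pi * \<i>) * (2 * complex_of_real pi * \<i> * (\<Sum>z\<in>S. residue ?f z)) =
      (\<Sum>z\<in>S. cinner (spectral_projection [circlepath z r] T u) v)"
    by (simp add: circle_projection_residue[OF T S(2)])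
  also have "\<dots> = cinner ((\<Sum>z\<in>S. spectral_projection [circlepath z r] T) u) v"
    by (simp add: blinfun.sum_left cinner.sum_left)
  finally show "cinner (spectral_projection \<Gamma> T u) v =
    cinner ((\<Sum>z\<in>S. spectral_projection [circlepath z r] T) u) v" .
qed

lemma contour_integral_circlepath_outside:
  assumes "\<xi> \<notin> cball w r" "r > 0"
  shows "((\<lambda>\<eta>. a / (\<eta> - \<xi>)) has_contour_integral 0) (circlepath w r)"
  using assms by (intro Cauchy_theorem_convex_simple[of _ "cball w r"] holomorphic_intros) auto

text \<open>The classical double contour integral: the resolvent identity splits the product of
  resolvents into partial fractions, and Cauchy's formula evaluates each according to which circle
  encloses the pole.\<close>

lemma circle_projection_mult:
  fixes T :: "'a::chilbert_space graph"
  assumes T: "linear_operator T" and z: "isolated_radius T z r" and w: "isolated_radius T w r"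
  shows "spectral_projection [circlepath z r] T (spectral_projection [circlepath w r] T u) =
    (if z = w then spectral_projection [circlepath w r] T u else 0)"
proof (rule cinner_ext)
  fix v
  have r: "r > 0" using z by (simp add: isolated_radius_def)
  have far: "dist z w > r" if "z \<noteq> w"
    using isolated_radius_resolvent[OF z, of w] isolated_radius_spectrum[OF w] that by force
  \<comment> \<open>Radii \<open>r / 2\<close> and \<open>r / 4\<close> make the closed discs
    strictly nested for \<open>z = w\<close> and disjoint otherwise, because
    \<open>r / 2 + r / 4 < r < dist z w\<close>.\<close>
  have z2: "isolated_radius T z (r / 2)" and w4: "isolated_radius T w (r / 4)"
    using z w r by (auto intro: isolated_radius_mono)
  define E where "E = spectral_projection [circlepath w r] T"
  have E: "E = spectral_projection [circlepath w (r / 4)] T"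
    unfolding E_def by (rule circle_projection_radius[OF T w w4])
  let ?R = "resolvent T"
  define f where "f \<xi> = cinner (?R \<xi> u) v" for \<xi>
  have f: "f holomorphic_on resolvent_set T"
    unfolding f_def by (rule holomorphic_on_resolvent_functional[OF T])
  define c where "c = 2 * complex_of_real pi * \<i>"
  have c0: "c \<noteq> 0" by (simp add: c_def)
  have P2: "path_image (circlepath z (r / 2)) \<subseteq> resolvent_set T"
    and P4: "path_image (circlepath w (r / 4)) \<subseteq> resolvent_set T"
    by (rule isolated_radius_path[OF z2], rule isolated_radius_path[OF w4])
  have out: "\<xi> \<notin> cball w (r / 4)" if "\<xi> \<in> path_image (circlepath z (r / 2))" for \<xi>
  proof (cases "z = w")
    case False
    have "dist z w \<le> dist z \<xi> + dist w \<xi>" by (metis dist_commute dist_triangle)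
    then show ?thesis using that r far[OF False] by auto
  qed (use that r in auto)
  have out': "\<eta> \<notin> cball z (r / 2)" if "\<eta> \<in> path_image (circlepath w (r / 4))" "z \<noteq> w" for \<eta>
  proof -
    have "dist z w \<le> dist z \<eta> + dist w \<eta>" by (metis dist_commute dist_triangle)
    then show ?thesis using that r far by auto
  qed
  have f_cont: "continuous_on (path_image (circlepath w (r / 4))) f"
    using holomorphic_on_imp_continuous_on[OF f] P4 by (rule continuous_on_subset)
  have inner: "cinner (?R \<xi> (E u)) v = 1 / c * contour_integral (circlepath w (r / 4)) (\<lambda>\<eta>. f \<eta> / (\<xi> - \<eta>))"
    if \<xi>: "\<xi> \<in> path_image (circlepath z (r / 2))" for \<xi>
  proof -
    have \<xi>\<rho>: "\<xi> \<in> resolvent_set T" using P2 \<xi> by blast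
    have ne: "\<eta> - \<xi> \<noteq> 0" if "\<eta> \<in> path_image (circlepath w (r / 4))" for \<eta>
      using out[OF \<xi>] that r by auto
    let ?\<phi> = "\<lambda>A. cinner (?R \<xi> (blinfun_apply A u)) v"
    have \<phi>: "bounded_linear ?\<phi>" "?\<phi> (scaleC_blinfun k A) = k * ?\<phi> A" for k A
      using complex_linear_resolvent[OF T \<xi>\<rho>]
      by (auto simp: complex_linear_def cinner_scaleC_left
        intro!: bounded_linear_compose[OF cinner.bounded_linear_left]
          bounded_linear_compose[OF blinfun.bounded_linear_right] blinfun.bounded_linear_left)
    have int: "(\<lambda>\<eta>. f \<eta> / (\<xi> - \<eta>)) contour_integrable_on circlepath w (r / 4)"
      using ne r by (intro contour_integrable_continuous_circlepath continuous_intros f_cont) force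
    have "?\<phi> E = 1 / c * contour_integral (circlepath w (r / 4)) (\<lambda>\<eta>. ?\<phi> (?R \<eta>))"
      unfolding E c_def using spectral_projection_functional[OF T _ \<phi>, of "[circlepath w (r / 4)]"] P4
      by simp
    \<comment> \<open>Partial fractions. The term with \<open>f \<xi>\<close> integrates to zero
      over \<open>\<eta>\<close> since its pole \<open>\<xi>\<close> lies outside the small
      disc.\<close>
    also have "contour_integral (circlepath w (r / 4)) (\<lambda>\<eta>. ?\<phi> (?R \<eta>)) =
        contour_integral (circlepath w (r / 4)) (\<lambda>\<eta>. f \<xi> / (\<eta> - \<xi>) + f \<eta> / (\<xi> - \<eta>))"
    proof (rule contour_integral_eq)
      fix \<eta> assume \<eta>: "\<eta> \<in> path_image (circlepath w (r / 4))"
      then have "\<eta> \<in> resolvent_set T" using P4 by blast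
      then have "f \<xi> - f \<eta> = (\<eta> - \<xi>) * ?\<phi> (?R \<eta>)"
        unfolding f_def cinner.diff_left[symmetric] using resolvent_identity[OF \<xi>\<rho> _ T]
        by (simp add: cinner_scaleC_left)
      then have "?\<phi> (?R \<eta>) = (f \<xi> - f \<eta>) / (\<eta> - \<xi>)" using ne[OF \<eta>] by simp
      also have "\<dots> = f \<xi> / (\<eta> - \<xi>) + f \<eta> / (\<xi> - \<eta>)"
        by (simp add: diff_divide_distrib minus_divide_right)
      finally show "?\<phi> (?R \<eta>) = f \<xi> / (\<eta> - \<xi>) + f \<eta> / (\<xi> - \<eta>)" .
    qed
    also have "\<dots> = 0 + contour_integral (circlepath w (r / 4)) (\<lambda>\<eta>. f \<eta> / (\<xi> - \<eta>))"
      using contour_integral_circlepath_outside[OF out[OF \<xi>]] r int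
      by (intro contour_integral_unique has_contour_integral_add has_contour_integral_integral) auto
    finally show ?thesis by simp
  qed
  have "cinner (spectral_projection [circlepath z r] T (E u)) v =
      1 / c * contour_integral (circlepath z (r / 2)) (\<lambda>\<xi>. cinner (?R \<xi> (E u)) v)"
    unfolding circle_projection_radius[OF T z z2] c_def
    using spectral_projection_functional[OF T, of "[circlepath z (r / 2)]" "\<lambda>A. cinner (A (E u)) v"] P2
    by (simp add: bounded_linear_cinner_apply cinner_scaleC_left)
  also have "contour_integral (circlepath z (r / 2)) (\<lambda>\<xi>. cinner (?R \<xi> (E u)) v) =
      contour_integral (circlepath z (r / 2))
        (\<lambda>\<xi>. 1 / c * contour_integral (circlepath w (r / 4)) (\<lambda>\<eta>. f \<eta> / (\<xi> - \<eta>)))"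
    by (intro contour_integral_eq inner)
  also have "\<dots> = contour_integral (circlepath z (r / 2))
        (\<lambda>\<xi>. contour_integral (circlepath w (r / 4)) (\<lambda>\<eta>. 1 / c * (f \<eta> / (\<xi> - \<eta>))))"
    by (intro contour_integral_eq contour_integral_lmul[symmetric]
        contour_integrable_continuous_circlepath continuous_intros f_cont)
      (use out r in force)
  also have "\<dots> = contour_integral (circlepath w (r / 4))
        (\<lambda>\<eta>. contour_integral (circlepath z (r / 2)) (\<lambda>\<xi>. 1 / c * (f \<eta> / (\<xi> - \<eta>))))"
  proof (rule contour_integral_swap)
    have ne: "fst p - snd p \<noteq> 0"
      if "p \<in> path_image (circlepath z (r / 2)) \<times> path_image (circlepath w (r / 4))" for p
      using that out[of "fst p"] r by auto
    show "continuous_on (path_image (circlepath z (r / 2)) \<times> path_image (circlepath w (r / 4)))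
        (\<lambda>(\<xi>, \<eta>). 1 / c * (f \<eta> / (\<xi> - \<eta>)))"
      unfolding case_prod_beta
      using ne by (intro continuous_intros continuous_on_compose2[OF f_cont]) auto
  qed (auto simp: vector_derivative_circlepath intro!: continuous_intros)
  \<comment> \<open>After the swap the inner integral is a Cauchy integral in \<open>\<xi>\<close>
    with pole \<open>\<eta>\<close>, which the circle around \<open>z\<close> encloses exactly when
    \<open>z = w\<close>.\<close>
  also have "\<dots> = contour_integral (circlepath w (r / 4)) (\<lambda>\<eta>. if z = w then f \<eta> else 0)"
  proof (rule contour_integral_eq)
    fix \<eta> assume \<eta>: "\<eta> \<in> path_image (circlepath w (r / 4))"
    show "contour_integral (circlepath z (r / 2)) (\<lambda>\<xi>. 1 / c * (f \<eta> / (\<xi> - \<eta>))) = (if z = w then f \<eta> else 0)"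
    proof (cases "z = w")
      case True
      have "cmod (\<eta> - z) < r / 2" using \<eta> r True by (auto simp: dist_norm norm_minus_commute)
      then have "((\<lambda>\<xi>. (1 / c * f \<eta>) / (\<xi> - \<eta>)) has_contour_integral 2 * complex_of_real pi * \<i> * (1 / c * f \<eta>))
          (circlepath z (r / 2))"
        by (intro Cauchy_integral_circlepath_simple) auto
      then show ?thesis using True c0 by (simp add: contour_integral_unique c_def)
    next
      case False
      show ?thesis
        using contour_integral_circlepath_outside[OF out'[OF \<eta> False], of "1 / c * f \<eta>"] r False
        by (simp add: contour_integral_unique)
    qed
  qed
  also have "1 / c * contour_integral (circlepath w (r / 4)) (\<lambda>\<eta>. if z = w then f \<eta> else 0) =
      cinner (if z = w then E u else 0) v"
  proof (cases "z = w")
    case True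
    have "cinner (E u) v = 1 / c * contour_integral (circlepath w (r / 4)) f"
      unfolding E c_def f_def
      using spectral_projection_functional[OF T, of "[circlepath w (r / 4)]" "\<lambda>A. cinner (A u) v"] P4
      by (simp add: bounded_linear_cinner_apply cinner_scaleC_left)
    then show ?thesis using True by simp
  qed (simp add: cinner.zero_left)
  finally show "cinner (spectral_projection [circlepath z r] T (spectral_projection [circlepath w r] T u)) v =
      cinner (if z = w then spectral_projection [circlepath w r] T u else 0) v"
    unfolding E_def .
qed

lemma spectral_projection_idempotent:
  fixes T :: "'a::chilbert_space graph"
  assumes T: "linear_operator T" and S: "finite S" "\<And>z. z \<in> S \<Longrightarrow> isolated_radius T z r"
    and \<Gamma>: "encloses_exactly \<Gamma> S (op_spectrum T)"
  shows "spectral_projection \<Gamma> T o\<^sub>L spectral_projection \<Gamma> T = spectral_projection \<Gamma> T"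
proof (rule blinfun_eqI)
  fix u
  have P: "spectral_projection \<Gamma> T = (\<Sum>z\<in>S. spectral_projection [circlepath z r] T)"
    by (rule spectral_projection_decompose[OF T S(1) _ \<Gamma>]) (rule S(2))
  let ?E = "\<lambda>z. spectral_projection [circlepath z r] T"
  have "(\<Sum>z\<in>S. ?E z (\<Sum>w\<in>S. ?E w u)) = (\<Sum>z\<in>S. \<Sum>w\<in>S. if z = w then ?E w u else 0)"
    unfolding blinfun.sum_right by (intro sum.cong circle_projection_mult T S(2) refl)
  also have "\<dots> = (\<Sum>z\<in>S. ?E z u)" using S(1) by (simp add: sum.delta)
  finally show "(spectral_projection \<Gamma> T o\<^sub>L spectral_projection \<Gamma> T) u = spectral_projection \<Gamma> T u"
    unfolding blinfun_apply_blinfun_compose P blinfun.sum_left .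
qed

lemma discrete_eigenvalues_radius:
  assumes "finite S" "S \<subseteq> discrete_eigenvalues T"
  obtains r where "\<And>z. z \<in> S \<Longrightarrow> isolated_radius T z r"
proof -
  have "\<exists>r>0. \<forall>z\<in>S. isolated_radius T z r"
    using assms
  proof (induction S rule: finite_induct)
    case (insert z S)
    then obtain r where r: "r > 0" "\<And>z. z \<in> S \<Longrightarrow> isolated_radius T z r" by auto
    obtain r' where r': "isolated_radius T z r'"
      using insert.prems unfolding discrete_eigenvalues_def isolated_radius_def by auto
    then have "r' > 0" by (simp add: isolated_radius_def)
    have "isolated_radius T x (min r r')" if "x \<in> insert z S" for x
      using that isolated_radius_mono[OF r(2), of x "min r r'"] isolated_radius_mono[OF r', of "min r r'"]
        r(1) \<open>r' > 0\<close> by auto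
    then show ?case using r(1) \<open>r' > 0\<close> by (intro exI[of _ "min r r'"]) auto
  qed (auto intro: exI[of _ 1])
  then show ?thesis using that by blast
qed

lemma finite_dimensional_range_sum:
  assumes "finite S" "\<And>z. z \<in> S \<Longrightarrow> finite_dimensional (range (blinfun_apply (E z)))"
  shows "finite_dimensional (range (blinfun_apply (\<Sum>z\<in>S. E z)))"
proof -
  obtain B where B: "\<And>z. z \<in> S \<Longrightarrow> finite (B z) \<and> range (blinfun_apply (E z)) \<subseteq> span (B z)"
    using assms(2) unfolding finite_dimensional_def by metis
  have "(\<Sum>z\<in>S. E z) u \<in> span (\<Union>z\<in>S. B z)" for u
    unfolding blinfun.sum_left
  proof (rule span_sum)
    fix z assume z: "z \<in> S"
    then have "E z u \<in> span (B z)" using B by blast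
    then show "E z u \<in> span (\<Union>z\<in>S. B z)" using span_mono[of "B z" "\<Union>z\<in>S. B z"] z by blast
  qed
  then show ?thesis
    unfolding finite_dimensional_def using B assms(1) by (intro exI[of _ "\<Union>z\<in>S. B z"]) auto
qed

lemma spectral_projection_finite_dimensional:
  fixes T :: "'a::chilbert_space graph"
  assumes T: "linear_operator T" and S: "finite S" "S \<subseteq> discrete_eigenvalues T"
    and r: "\<And>z. z \<in> S \<Longrightarrow> isolated_radius T z r"
    and \<Gamma>: "encloses_exactly \<Gamma> S (op_spectrum T)"
  shows "finite_dimensional (range (blinfun_apply (spectral_projection \<Gamma> T)))"
proof -
  have P: "spectral_projection \<Gamma> T = (\<Sum>z\<in>S. spectral_projection [circlepath z r] T)"
    by (rule spectral_projection_decompose[OF T S(1) _ \<Gamma>]) (rule r)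
  show ?thesis
    unfolding P
  proof (rule finite_dimensional_range_sum[OF S(1)])
    fix z assume z: "z \<in> S"
    then obtain r' where r': "isolated_radius T z r'"
      "finite_dimensional (range (blinfun_apply (spectral_projection [circlepath z r'] T)))"
      using S(2) unfolding discrete_eigenvalues_def isolated_radius_def by auto
    then show "finite_dimensional (range (blinfun_apply (spectral_projection [circlepath z r] T)))"
      using circle_projection_radius[OF T r'(1) r[OF z]] by simp
  qed
qed

section \<open>Symmetry of the spectral projection\<close>

text \<open>For imaginary \<open>z\<close> the reflection sends the angle \<open>\<theta>\<close> on
  the circle to \<open>\<pi> - \<theta>\<close>, that is, the parameter \<open>t\<close> to
  \<open>1/2 - t\<close>: reversal plus a half turn of the starting point.\<close>

lemma circlepath_reflect:
  assumes "Re z = 0"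
  shows "(\<lambda>t. - cnj (circlepath z r t)) = reversepath (shiftpath (1/2) (circlepath z r))"
proof
  fix t :: real
  define e where "e = exp (2 * complex_of_real pi * \<i> * t)"
  have e0: "e \<noteq> 0" by (simp add: e_def)
  have z: "- cnj z = z" using assms by (simp add: complex_eq_iff)
  have cnj_e: "cnj e = 1 / e"
    by (simp add: e_def exp_cnj exp_minus inverse_eq_divide)
  have half: "exp (2 * complex_of_real pi * \<i> * complex_of_real (1 / 2 - t)) = - (1 / e)"
  proof -
    have "2 * complex_of_real pi * \<i> * complex_of_real (1 / 2 - t) =
        complex_of_real pi * \<i> - 2 * complex_of_real pi * \<i> * t"
      by (simp add: algebra_simps)
    then show ?thesis by (simp add: exp_diff e_def)
  qed
  have three_half: "exp (2 * complex_of_real pi * \<i> * complex_of_real (3 / 2 - t)) = - (1 / e)"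
  proof -
    have "2 * complex_of_real pi * \<i> * complex_of_real (3 / 2 - t) =
        2 * complex_of_real pi * \<i> * complex_of_real (1 / 2 - t) + 2 * complex_of_real pi * \<i>"
      by (simp add: algebra_simps)
    then show ?thesis unfolding half[symmetric] by (simp add: exp_add)
  qed
  have "- cnj (circlepath z r t) = z + r * (- (1 / e))"
    unfolding circlepath e_def[symmetric] using z cnj_e by simp
  moreover have "reversepath (shiftpath (1/2) (circlepath z r)) t = z + r * (- (1 / e))"
  \<comment> \<open>The two branches of \<open>shiftpath\<close> give the parameters
    \<open>3/2 - t\<close> and \<open>1/2 - t\<close>, which differ by a full turn.\<close>
  proof (cases "1 / 2 + (1 - t) \<le> 1")
    case True
    then have "reversepath (shiftpath (1/2) (circlepath z r)) t = circlepath z r (3 / 2 - t)"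
      by (simp add: reversepath_def shiftpath_def)
    then show ?thesis unfolding circlepath three_half .
  next
    case False
    then have "reversepath (shiftpath (1/2) (circlepath z r)) t = circlepath z r (1 / 2 - t)"
      by (simp add: reversepath_def shiftpath_def)
    then show ?thesis unfolding circlepath half .
  qed
  ultimately show "- cnj (circlepath z r t) = reversepath (shiftpath (1/2) (circlepath z r)) t" by simp
qed

text \<open>The reflection in the imaginary axis maps the circle to itself and reverses its orientation.\<close>

lemma residue_reflect:
  assumes s: "open s" "z \<in> s" "r > 0" "cball z r \<subseteq> s"
    and k: "k holomorphic_on s - {z}" and h: "h holomorphic_on s - {z}"
    and z: "Re z = 0" and hk: "\<And>\<xi>. \<xi> \<in> sphere z r \<Longrightarrow> h \<xi> = - cnj (k (- cnj \<xi>))"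
  shows "residue h z = cnj (residue k z)"
proof -
  let ?c = "circlepath z r"
  define D where "D t = - cnj (?c t)" for t
  have "(k has_contour_integral complex_of_real (2 * pi) * \<i> * residue k z) (shiftpath (1/2) ?c)"
    by (intro has_contour_integral_shiftpath base_residue[OF s(1,2,3) k s(4)]) auto
  then have "(k has_contour_integral - (complex_of_real (2 * pi) * \<i> * residue k z)) D"
    unfolding D_def circlepath_reflect[OF z]
    by (intro has_contour_integral_reversepath valid_path_shiftpath) auto
  then have "((\<lambda>t. k (D t) * vector_derivative D (at t within {0..1})) has_integral
      - (complex_of_real (2 * pi) * \<i> * residue k z)) {0..1}"
    unfolding has_contour_integral_def .
  \<comment> \<open>Under conjugation the sign in \<open>h \<xi> = - cnj (k (- cnj \<xi>))\<close>
    absorbs the sign of the derivative of \<open>D\<close>, so the integrand of \<open>h\<close>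
    over the original circle appears. The sign from reversing the path cancels against
    \<open>cnj \<i> = - \<i>\<close>.\<close>
  then have "((cnj \<circ> (\<lambda>t. k (D t) * vector_derivative D (at t within {0..1}))) has_integral
      cnj (- (complex_of_real (2 * pi) * \<i> * residue k z))) {0..1}"
    by (rule has_integral_linear) (rule bounded_linear_cnj)
  moreover have "(cnj \<circ> (\<lambda>t. k (D t) * vector_derivative D (at t within {0..1}))) t =
      h (?c t) * vector_derivative ?c (at t within {0..1})" if t: "t \<in> {0..1}" for t
  proof -
    have c: "(?c has_vector_derivative vector_derivative ?c (at t within {0..1})) (at t within {0..1})"
      using has_vector_derivative_part_circlepath[of z r 0 "2 * pi" t "{0..1}"]
      unfolding circlepath_def by (metis differentiableI_vector vector_derivative_works)
    have "(D has_vector_derivative - cnj (vector_derivative ?c (at t within {0..1}))) (at t within {0..1})"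
      unfolding D_def by (intro has_vector_derivative_minus has_vector_derivative_cnj c)
    then have "vector_derivative D (at t within {0..1}) = - cnj (vector_derivative ?c (at t within {0..1}))"
      using t by (intro vector_derivative_within_cbox[of 0 1 t, simplified]) auto
    moreover have "?c t \<in> sphere z r"
      using path_image_circlepath_nonneg[of r z] s(3) t by (auto simp: path_image_def)
    ultimately show ?thesis by (simp add: hk D_def)
  qed
  ultimately have "((\<lambda>t. h (?c t) * vector_derivative ?c (at t within {0..1})) has_integral
      cnj (- (complex_of_real (2 * pi) * \<i> * residue k z))) {0..1}"
    by (subst (asm) has_integral_cong) auto
  then have "(h has_contour_integral complex_of_real (2 * pi) * \<i> * cnj (residue k z)) ?c"
    unfolding has_contour_integral_def by simp
  moreover have "(h has_contour_integral complex_of_real (2 * pi) * \<i> * residue h z) ?c"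
    by (rule base_residue[OF s(1,2,3) h s(4)])
  ultimately have "complex_of_real (2 * pi) * \<i> * cnj (residue k z) = complex_of_real (2 * pi) * \<i> * residue h z"
    by (rule has_contour_integral_unique)
  then show ?thesis by simp
qed

text \<open>The interface between the operators and the spectral argument: \<open>A\<close> stands
  for \<open>\<i>\<close> or \<open>- \<i>\<close> times the inverse of \<open>J\<close>, and
  \<open>T\<close> for the product \<open>J L\<close>. Skewness is expressed on pairs of the graph,
  so that domains stay implicit.\<close>

definition skew_wrt :: "('a::complex_inner \<Rightarrow>\<^sub>L 'a) \<Rightarrow> 'a graph \<Rightarrow> bool"
  where "skew_wrt A T \<longleftrightarrow> complex_linear A \<and> (\<forall>u v. cinner (A u) v = cinner u (A v)) \<and>
    (\<forall>u x v y. (u, x) \<in> T \<longrightarrow> (v, y) \<in> T \<longrightarrow> cinner (A x) v = - cinner (A u) y)"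

text \<open>With respect to the form \<open>cinner (A u) v\<close>, moving \<open>\<xi> - T\<close>
  to the other argument gives \<open>cnj \<xi> + T\<close>, which is minus
  \<open>(- cnj \<xi>) - T\<close>. This is where the reflected point comes from.\<close>

lemma resolvent_skew:
  assumes A: "skew_wrt A T" and \<xi>: "\<xi> \<in> resolvent_set T" "- cnj \<xi> \<in> resolvent_set T"
  shows "cinner (A (resolvent T \<xi> u)) v = - cinner (A u) (resolvent T (- cnj \<xi>) v)"
proof -
  let ?x = "resolvent T \<xi> u" and ?y = "resolvent T (- cnj \<xi>) v"
  have "cinner (A (\<xi> *\<^sub>C ?x - u)) ?y = - cinner (A ?x) ((- cnj \<xi>) *\<^sub>C ?y - v)"
    using A resolvent_graph[OF \<xi>(1), of u] resolvent_graph[OF \<xi>(2), of v] unfolding skew_wrt_def by blast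
  moreover have "A (\<xi> *\<^sub>C ?x - u) = \<xi> *\<^sub>C A ?x - A u"
    using A by (simp add: skew_wrt_def complex_linear_def blinfun.diff_right)
  ultimately show ?thesis
    by (simp add: cinner.diff_left cinner.diff_right cinner_scaleC_left cinner_scaleC_right eq_neg_iff_add_eq_0 algebra_simps)
qed

lemma circle_projection_symmetric:
  fixes T :: "'a::chilbert_space graph"
  assumes T: "linear_operator T" and A: "skew_wrt A T" and z: "isolated_radius T z r" "Re z = 0"
  shows "cinner (A (spectral_projection [circlepath z r] T u)) v =
    cinner (A u) (spectral_projection [circlepath z r] T v)"
proof -
  let ?E = "spectral_projection [circlepath z r] T"
  have sym: "cinner (A u) v = cinner u (A v)" for u v using A by (simp add: skew_wrt_def)
  have zc: "- cnj z = z" using z(2) by (simp add: complex_eq_iff)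
  have "residue (\<lambda>\<xi>. cinner (resolvent T \<xi> u) (A v)) z = cnj (residue (\<lambda>\<xi>. cinner (resolvent T \<xi> v) (A u)) z)"
  proof (rule residue_reflect[where s = "resolvent_set T \<union> {z}" and r = r])
    show "open (resolvent_set T \<union> {z})" using open_insert_isolated[OF T, of "{z}" r] z by simp
    show "cball z r \<subseteq> resolvent_set T \<union> {z}" using isolated_radius_resolvent[OF z(1)] by fastforce
    show "(\<lambda>\<xi>. cinner (resolvent T \<xi> u) v) holomorphic_on resolvent_set T \<union> {z} - {z}" for u v
      by (rule holomorphic_on_subset[OF holomorphic_on_resolvent_functional[OF T]]) auto
    then show "(\<lambda>\<xi>. cinner (resolvent T \<xi> u) v) holomorphic_on resolvent_set T \<union> {z} - {z}" for u v .
    fix \<xi> assume \<xi>: "\<xi> \<in> sphere z r"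
    have "dist z (- cnj \<xi>) = dist z \<xi>"
      using complex_mod_cnj[of "z - \<xi>"] zc by (metis complex_cnj_diff dist_norm minus_diff_minus norm_minus_cancel)
    then have "\<xi> \<in> resolvent_set T" "- cnj \<xi> \<in> resolvent_set T"
      using \<xi> z(1) by (auto intro!: isolated_radius_resolvent[OF z(1)] simp: isolated_radius_def)
    from resolvent_skew[OF A this, of u v]
    show "cinner (resolvent T \<xi> u) (A v) = - cnj (cinner (resolvent T (- cnj \<xi>) v) (A u))"
      by (simp add: sym cinner_commute[symmetric])
  qed (use z in \<open>auto simp: isolated_radius_def\<close>)
  then have "cinner (?E u) (A v) = cnj (cinner (?E v) (A u))"
    by (simp add: circle_projection_residue[OF T z(1)])
  then show ?thesis by (simp add: sym cinner_commute[symmetric])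
qed

lemma spectral_projection_symmetric:
  fixes T :: "'a::chilbert_space graph"
  assumes T: "linear_operator T" and A: "skew_wrt A T"
    and S: "finite S" "\<And>z. z \<in> S \<Longrightarrow> isolated_radius T z r" "\<And>z. z \<in> S \<Longrightarrow> Re z = 0"
    and \<Gamma>: "encloses_exactly \<Gamma> S (op_spectrum T)"
  shows "cinner (A (spectral_projection \<Gamma> T u)) v = cinner (A u) (spectral_projection \<Gamma> T v)"
proof -
  have P: "spectral_projection \<Gamma> T = (\<Sum>z\<in>S. spectral_projection [circlepath z r] T)"
    by (rule spectral_projection_decompose[OF T S(1) _ \<Gamma>]) (rule S(2))
  show ?thesis
    unfolding P blinfun.sum_left blinfun.sum_right cinner.sum_left cinner.sum_right
    by (intro sum.cong refl circle_projection_symmetric[OF T A] S(2,3))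
qed

text \<open>Skewness at the pair \<open>(u, z *\<^sub>C u)\<close> reads
  \<open>z * q = - cnj z * q\<close> with \<open>q = cinner (A u) u\<close>.\<close>

lemma eigenvalue_imaginary:
  assumes A: "skew_wrt A T" and u: "(u, z *\<^sub>C u) \<in> T" "cinner (A u) u \<noteq> 0"
  shows "Re z = 0"
proof -
  have "cinner (A (z *\<^sub>C u)) u = - cinner (A u) (z *\<^sub>C u)"
    using A u(1) unfolding skew_wrt_def by blast
  moreover have "A (z *\<^sub>C u) = z *\<^sub>C A u" using A by (simp add: skew_wrt_def complex_linear_def)
  ultimately have "(z + cnj z) * cinner (A u) u = 0"
    by (simp add: cinner_scaleC_left cinner_scaleC_right algebra_simps)
  then have "z + cnj z = 0" using u(2) by simp
  then show ?thesis by (simp add: complex_eq_iff)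
qed

lemma definite_eigenvalues_imaginary:
  assumes "skew_wrt A T" "positive_definite_on X (\<lambda>u. inner (A u) u)" "z \<in> eigenvalues_on T X"
  shows "Re z = 0"
proof -
  obtain u where u: "u \<in> X" "u \<noteq> 0" "(u, z *\<^sub>C u) \<in> T"
    using assms(3) unfolding eigenvalues_on_def by blast
  then have "inner (A u) u > 0" using assms(2) unfolding positive_definite_on_def by blast
  then have "cinner (A u) u \<noteq> 0" by (auto simp: inner_cinner)
  then show ?thesis by (rule eigenvalue_imaginary[OF assms(1) u(3)])
qed

proposition positive_definite_eigenvalue_system:
  fixes T :: "real \<Rightarrow> 'a::chilbert_space graph"
  assumes rc: "resolvent_continuous_on I T" and I': "I' \<subseteq> I"
    and sys: "eigenvalue_system I' T S P"
    and A: "\<And>s. s \<in> I' \<Longrightarrow> skew_wrt A (T s)" and inj: "\<And>u. A u = 0 \<Longrightarrow> u = 0"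
    and s0: "s\<^sub>0 \<in> I'" "positive_definite_on (range (blinfun_apply (P s\<^sub>0))) (\<lambda>u. inner (A u) u)"
    and s: "s \<in> I'"
  shows "positive_definite_on (range (blinfun_apply (P s))) (\<lambda>u. inner (A u) u)"
    and "\<And>z. z \<in> S s \<Longrightarrow> Re z = 0"
proof -
  have lin: "linear_operator (T s)" if "s \<in> I'" for s
    using rc that I' unfolding resolvent_continuous_on_def by blast
  have loc: "finite (S s) \<and> S s \<subseteq> discrete_eigenvalues (T s) \<and>
      S s = eigenvalues_on (T s) (range (blinfun_apply (P s))) \<and>
      (\<exists>\<Gamma>. encloses_exactly \<Gamma> (S s) (op_spectrum (T s)) \<and> P s = spectral_projection \<Gamma> (T s))"
    if s: "s \<in> I'" for s
  proof -
    obtain \<Gamma> \<delta> where "finite (S s)" "S s \<subseteq> discrete_eigenvalues (T s)"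
      "encloses_exactly \<Gamma> (S s) (op_spectrum (T s))" "\<delta> > 0"
      and *: "\<forall>t\<in>I' \<inter> ball s \<delta>. (\<forall>\<gamma>\<in>set \<Gamma>. path_image \<gamma> \<subseteq> resolvent_set (T t)) \<and>
        P t = spectral_projection \<Gamma> (T t) \<and> S t = eigenvalues_on (T t) (range (blinfun_apply (P t)))"
      using sys s unfolding eigenvalue_system_def by metis
    moreover from this have "s \<in> I' \<inter> ball s \<delta>" using s by simp
    with * have "P s = spectral_projection \<Gamma> (T s)" "S s = eigenvalues_on (T s) (range (blinfun_apply (P s)))"
      by blast+
    ultimately show ?thesis by blast
  qed
  have sym: "cinner (A u) v = cinner u (A v)" for u v using A[OF s] by (simp add: skew_wrt_def)
  have "connected I'" using sys by (simp add: eigenvalue_system_def is_interval_connected)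
  then show pos: "positive_definite_on (range (blinfun_apply (P s))) (\<lambda>u. inner (A u) u)"
  proof (rule positive_definite_range_continuation[rotated 2, OF _ continuous_on_eigenvalue_system[OF rc I' sys] _ _ _ s0 s])
    show "inner (A u) v = inner u (A v)" for u v by (simp add: inner_cinner sym)
    show "u = 0" if "A u = 0" for u using that by (rule inj)
    fix t assume t: "t \<in> I'"
    obtain \<Gamma> where S: "finite (S t)" "S t \<subseteq> discrete_eigenvalues (T t)"
      and ev: "S t = eigenvalues_on (T t) (range (blinfun_apply (P t)))"
      and \<Gamma>: "encloses_exactly \<Gamma> (S t) (op_spectrum (T t))" "P t = spectral_projection \<Gamma> (T t)"
      using loc[OF t] by blast
    obtain r where r: "\<And>z. z \<in> S t \<Longrightarrow> isolated_radius (T t) z r"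
      using discrete_eigenvalues_radius[OF S] by blast
    show "P t o\<^sub>L P t = P t"
      unfolding \<Gamma>(2) by (rule spectral_projection_idempotent[OF lin[OF t] S(1) _ \<Gamma>(1)]) (rule r)
    show "finite_dimensional (range (blinfun_apply (P t)))"
      unfolding \<Gamma>(2) by (rule spectral_projection_finite_dimensional[OF lin[OF t] S _ \<Gamma>(1)]) (rule r)
    assume "positive_definite_on (range (blinfun_apply (P t))) (\<lambda>u. inner (A u) u)"
    \<comment> \<open>Definiteness at \<open>t\<close> itself puts the eigenvalues on the axis and
      thereby makes \<open>P t\<close> symmetric: precisely the conditional symmetry that the
      continuation argument asks for.\<close>
    then have "Re z = 0" if "z \<in> S t" for z
      using definite_eigenvalues_imaginary[OF A[OF t]] that ev by blast
    then have "cinner (A (P t u)) v = cinner (A u) (P t v)" for u v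
      unfolding \<Gamma>(2) using spectral_projection_symmetric[OF lin[OF t] A[OF t] S(1) _ _ \<Gamma>(1)] r by blast
    then show "inner (A (P t u)) v = inner (A u) (P t v)" for u v by (simp add: inner_cinner)
  qed
  show "Re z = 0" if "z \<in> S s" for z
    using definite_eigenvalues_imaginary[OF A[OF s] pos] that loc[OF s] by blast
qed

section \<open>The Hermitian form attached to \<open>J\<close> and the product of \<open>J\<close>
  with \<open>L\<close>\<close>

lemma op_app_eq: "linear_operator T \<Longrightarrow> (u, v) \<in> T \<Longrightarrow> op_app T u = v"
  unfolding linear_operator_def op_app_def by (rule the_equality) (auto dest: single_valuedD)

text \<open>Every vector is \<open>J\<close> of some \<open>B u\<close>, so skew-symmetry of
  \<open>J\<close> on its domain, evaluated at \<open>B u\<close> and \<open>B v\<close>, becomes an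
  identity for all \<open>u\<close> and \<open>v\<close>.\<close>

lemma skew_symmetric_inverse:
  assumes J: "skew_symmetric_operator J" and B: "J\<inverse> = bounded_operator_graph B"
  shows "cinner (B u) v = - cinner u (B v)" "complex_linear B" "B u = 0 \<Longrightarrow> u = 0"
    "op_app (J\<inverse>) u = B u"
proof -
  have lin: "linear_operator J" using J by (simp add: skew_symmetric_operator_def)
  have JB: "(u, v) \<in> J \<longleftrightarrow> u = B v" for u v using B by (simp add: converse_eq_graph_iff)
  have app: "op_app J (B u) = u" for u using lin JB by (intro op_app_eq) auto
  have dom: "B u \<in> Domain J" for u using JB by auto
  have "cinner (op_app J (B u)) (B v) = - cinner (B u) (op_app J (B v))" for u v
    using J dom unfolding skew_symmetric_operator_def by blast
  then have "cinner u (B v) = - cinner (B u) v" for u v by (simp add: app)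
  then show "cinner (B u) v = - cinner u (B v)" by simp
  show "complex_linear B"
    using lin JB unfolding complex_linear_def linear_operator_def by metis
  show "u = 0" if "B u = 0" using app[of u] app[of 0] that by (simp add: blinfun.zero_right)
  show "op_app (J\<inverse>) u = B u" unfolding B op_app_def bounded_operator_graph_def by auto
qed

text \<open>A pair \<open>(u, x)\<close> of the product satisfies \<open>B x = L u\<close>: the
  inverse cancels \<open>J\<close>, so skewness of the product is symmetry of \<open>L\<close>
  followed by skewness of \<open>B\<close>. An imaginary \<open>c\<close> makes \<open>c B\<close>
  Hermitian.\<close>

lemma skew_wrt_product:
  assumes J: "skew_symmetric_operator J" "J\<inverse> = bounded_operator_graph B"
    and L: "symmetric_operator L" and c: "Re c = 0"
  shows "skew_wrt (scaleC_blinfun c B) (L O J)"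
  unfolding skew_wrt_def
proof (intro conjI allI impI)
  note B = skew_symmetric_inverse[OF J]
  have cc: "cnj c = - c" using c by (simp add: complex_eq_iff)
  show "complex_linear (scaleC_blinfun c B)"
    using B(2) by (simp add: complex_linear_def scaleC_scaleC mult.commute)
  show "cinner (scaleC_blinfun c B u) v = cinner u (scaleC_blinfun c B v)" for u v
    by (simp add: cinner_scaleC_left cinner_scaleC_right B(1)[of u v] cc)
  fix u x v y assume ux: "(u, x) \<in> L O J" and vy: "(v, y) \<in> L O J"
  then have L': "(u, B x) \<in> L" "(v, B y) \<in> L"
    using J(2) by (auto simp: converse_eq_graph_iff)
  have "linear_operator L" using L by (simp add: symmetric_operator_def)
  then have "op_app L u = B x" "op_app L v = B y" using L' by (auto intro: op_app_eq)
  moreover have "cinner (op_app L u) v = cinner u (op_app L v)"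
    using L L' unfolding symmetric_operator_def by blast
  ultimately have "cinner (B x) v = - cinner (B u) y" by (simp add: B(1)[of u y])
  then show "cinner (scaleC_blinfun c B x) v = - cinner (scaleC_blinfun c B u) y"
    by (simp add: cinner_scaleC_left)
qed

theorem theorem3:
  fixes J :: "'a::chilbert_space graph"
    and L :: "real \<Rightarrow> 'a graph"
    and I I' :: "real set"
    and S :: "real \<Rightarrow> complex set"
    and P :: "real \<Rightarrow> 'a \<Rightarrow>\<^sub>L 'a"
    and X\<^sub>1 :: "real \<Rightarrow> 'a set"
    and s\<^sub>0 :: real
  assumes "skew_symmetric_operator J" and "has_bounded_inverse J"
    and "is_interval I"
    and "\<And>s. s \<in> I \<Longrightarrow> symmetric_operator (L s)"
    and "resolvent_continuous_on I (\<lambda>s. L s O J)"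
    and "maximal_eigenvalue_system I I' (\<lambda>s. L s O J) S P"
    and "\<And>s. s \<in> I' \<Longrightarrow> X\<^sub>1 s = range (blinfun_apply (P s))"
    and "s\<^sub>0 \<in> I'"
  shows "(positive_definite_on (X\<^sub>1 s\<^sub>0) (energy_form J) \<longrightarrow>
           (\<forall>s\<in>I'. positive_definite_on (X\<^sub>1 s) (energy_form J))) \<and>
         (negative_definite_on (X\<^sub>1 s\<^sub>0) (energy_form J) \<longrightarrow>
           (\<forall>s\<in>I'. negative_definite_on (X\<^sub>1 s) (energy_form J))) \<and>
         (positive_definite_on (X\<^sub>1 s\<^sub>0) (energy_form J) \<or>
          negative_definite_on (X\<^sub>1 s\<^sub>0) (energy_form J) \<longrightarrow>
           (\<forall>s\<in>I'. \<forall>z\<in>S s. Re z = 0))"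
proof -
  obtain B where B: "J\<inverse> = bounded_operator_graph B"
    using assms(2) unfolding has_bounded_inverse_def by blast
  note B' = skew_symmetric_inverse[OF assms(1) B]
  have I': "I' \<subseteq> I" and sys: "eigenvalue_system I' (\<lambda>s. L s O J) S P"
    using assms(6) by (auto simp: maximal_eigenvalue_system_def)
  have energy: "energy_form J u = inner (scaleC_blinfun \<i> B u) u"
    "- energy_form J u = inner (scaleC_blinfun (- \<i>) B u) u" for u
    by (simp_all add: energy_form_def B'(4) inner_cinner cinner_scaleC_left)
  have inj: "u = 0" if "scaleC_blinfun c B u = 0" "c \<noteq> 0" for c u
  proof -
    have "cmod c * norm (B u) = 0" using that(1) by (metis blinfun_apply_scaleC_blinfun norm_scaleC norm_zero)
    then show ?thesis using that(2) B'(3) by simp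
  qed
  have skew: "skew_wrt (scaleC_blinfun c B) (L s O J)" if "s \<in> I'" "Re c = 0" for c s
    using skew_wrt_product[OF assms(1) B assms(4)] I' that by blast
  \<comment> \<open>Both signs at once: \<open>c = \<i>\<close> serves the positive definite case
    and \<open>c = - \<i>\<close> the negative definite one.\<close>
  have main: "positive_definite_on (X\<^sub>1 s) (\<lambda>u. inner (scaleC_blinfun c B u) u) \<and> (\<forall>z\<in>S s. Re z = 0)"
    if "Re c = 0" "c \<noteq> 0" "positive_definite_on (X\<^sub>1 s\<^sub>0) (\<lambda>u. inner (scaleC_blinfun c B u) u)" "s \<in> I'" for c s
  proof -
    note * = positive_definite_eigenvalue_system[OF assms(5) I' sys, of "scaleC_blinfun c B" s\<^sub>0 s,
        OF skew[OF _ that(1)] inj[OF _ that(2)] assms(8) that(3)[unfolded assms(7)[OF assms(8)]] that(4)]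
    show ?thesis unfolding assms(7)[OF that(4)] using * by blast
  qed
  have neg: "negative_definite_on X (energy_form J) \<longleftrightarrow>
      positive_definite_on X (\<lambda>u. inner (scaleC_blinfun (- \<i>) B u) u)" for X
    unfolding energy(2)[symmetric] by (simp add: negative_definite_on_def positive_definite_on_def)
  have pos: "positive_definite_on X (energy_form J) \<longleftrightarrow>
      positive_definite_on X (\<lambda>u. inner (scaleC_blinfun \<i> B u) u)" for X
    unfolding energy(1)[symmetric] ..
  show ?thesis
    unfolding pos neg using main[of \<i>] main[of "- \<i>"] by simp
qed

end
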